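(* Let $X=\{X_n,n\ge0\}$ be a time-homogeneous Markov chain on $\mathbb{R}^+$ with jumps $\xi(x)$. Assume that, for some $b>0$ and $\mu>-b/2$, $$\mathbb{E}\xi(x)\sim\mu/x\quad\text{and}\quad\mathbb{E}\xi^2(x)\to b\qquad\text{as }x\to\infty$$ and that the family $\{\xi^2(x),x\ge0\}$ possesses an integrable majorant $\Xi$, that is, there is a random variable $\Xi$ with $\mathbb{E}\Xi<\infty$ and $$\xi^2(x)\le_{st}\Xi\qquad\text{for all }x .$$ If $X_n\to\infty$ in probability as $n\to\infty$, then $X_n^2/n$ converges weakly to the $\Gamma$-distribution with mean $2\mu+b$ and variance $(2\mu+b)2b$.
   Context: $\xi(x)$ denotes a random variable distributed as the jump of the chain from the state $x\in\mathbb{R}^+$, i.e. $\mathbb{P}\{\xi(x)\in D\}=\mathbb{P}\{X_{n+1}-X_n\in D\mid X_n=x\}$ for Borel $D$. The relation $\mathbb{E}\xi(x)\sim\mu/x$ is understood as $x\,\mathbb{E}\xi(x)\to\mu$. The relation $\eta\le_{st}\Xi$ means $\mathbb{P}\{\eta>t\}\le\mathbb{P}\{\Xi>t\}$ for all $t$. $X_n\to\infty$ in probability means $\mathbb{P}\{X_n>c\}\to1$ for every $c$. *)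

theory Defs
  imports "HOL-Probability.Probability"
begin

definition natural_filtration ::
  "'a measure \<Rightarrow> 's measure \<Rightarrow> (nat \<Rightarrow> 'a \<Rightarrow> 's) \<Rightarrow> nat \<Rightarrow> 'a measure" where
  "natural_filtration M S X n =
     sigma (space M) (\<Union>i\<in>{..n}. {X i -` A \<inter> space M | A. A \<in> sets S})"

text \<open>Time-homogeneous Markov chain with state space \<open>S\<close>, transition kernel \<open>P\<close>
  and arbitrary initial distribution.\<close>

locale markov_chain = prob_space M
  for M :: "'a measure" and S :: "'s measure"
    and P :: "'s \<Rightarrow> 's measure" and X :: "nat \<Rightarrow> 'a \<Rightarrow> 's" +
  assumes kernel: "P \<in> S \<rightarrow>\<^sub>M prob_algebra S"
    and random_variable_X: "\<And>n. X n \<in> M \<rightarrow>\<^sub>M S"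
    and markov_property: "\<And>n D. D \<in> sets S \<Longrightarrow>
      AE \<omega> in M. real_cond_exp M (natural_filtration M S X n)
        (\<lambda>\<omega>'. indicator D (X (Suc n) \<omega>')) \<omega> = measure (P (X n \<omega>)) D"

definition nonneg_reals :: "real measure" where
  "nonneg_reals = restrict_space borel {0..}"

definition jump_law :: "(real \<Rightarrow> real measure) \<Rightarrow> real \<Rightarrow> real measure" where
  "jump_law P x = distr (P x) borel (\<lambda>y. y - x)"

text \<open>Stochastic order between random variables, possibly on different probability spaces.\<close>

definition st_le :: "'a measure \<Rightarrow> ('a \<Rightarrow> real) \<Rightarrow> 'b measure \<Rightarrow> ('b \<Rightarrow> real) \<Rightarrow> bool" where
  "st_le M Y N Z \<longleftrightarrow>
     (\<forall>t. measure M {\<omega> \<in> space M. Y \<omega> > t} \<le> measure N {\<omega> \<in> space N. Z \<omega> > t})"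

text \<open>Shape \<open>k\<close>, scale \<open>\<theta>\<close>.\<close>

definition gamma_density :: "real \<Rightarrow> real \<Rightarrow> real \<Rightarrow> real" where
  "gamma_density k \<theta> x =
     (if x > 0 then x powr (k - 1) * exp (- x / \<theta>) / (Gamma k * \<theta> powr k) else 0)"

definition gamma_distribution :: "real \<Rightarrow> real \<Rightarrow> real measure" where
  "gamma_distribution k \<theta> = density lborel (\<lambda>x. ennreal (gamma_density k \<theta> x))"

end

theory Submission
  imports Defs
begin

text \<open>
  Far from the origin the chain has drift \<open>\<mu>/x\<close> and diffusion coefficient \<open>b\<close>, so on the diffusive
  scale it should behave like the Bessel process with generator
  \<open>(\<mu>/x) \<partial>\<^sub>x + (b/2) \<partial>\<^sub>x\<^sup>2\<close>, whose square at time \<open>1\<close>, started from \<open>0\<close>, has the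
  \<open>\<Gamma>\<close>-distribution with shape \<open>k = (2\<mu> + b)/(2b)\<close> and scale \<open>2b\<close>. The Laplace
  transform of the square of that process is explicit, and it can be followed along the chain. The functions
  \<open>bessel_heat k s x = s\<^sup>-\<^sup>k exp (-x\<^sup>2/s)\<close> solve the backward equation when \<open>s\<close> decreases at rate
  \<open>2b\<close>, because \<open>2bk = 2\<mu> + b\<close>. Hence, if \<open>s\<close> drops by \<open>2b\<close> with each step of
  the chain and ends at \<open>n/l\<close>, then \<open>bessel_heat k s\<close> evaluated along the chain is nearly a martingale.
  Its terminal value is, up to the factor \<open>(n/l)\<^sup>k\<close>, equal to \<open>exp (-l X\<^sub>n\<^sup>2/n)\<close>. After multiplication
  by the same factor, its initial value tends to \<open>(1 + 2bl)\<^sup>-\<^sup>k\<close>, because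
  \<open>X\<^sub>0\<^sup>2/n\<close> vanishes in the limit; this is the Laplace transform of the \<open>\<Gamma>\<close>-distribution.

  The work lies in the martingale defect of one step. It is at most \<open>s\<^sup>-\<^sup>k\<^sup>-\<^sup>1 (\<epsilon> + D 1{x \<le> c})\<close>
  for all large \<open>s\<close> and all states \<open>x\<close> (\<open>uniform_bessel_heat_one_step\<close>): the third order Taylor remainder
  is small because the squared jumps are uniformly integrable, which is what the majorant provides, and
  the first two moments are close to their limits once \<open>x > c\<close>. As \<open>s \<ge> n/l\<close>
  throughout, the \<open>n\<close> defects, multiplied by \<open>(n/l)\<^sup>k\<close>, add up to at most \<open>l \<epsilon>\<close> plus a multiple of
  the mean fraction of time before \<open>n\<close> spent in \<open>[0, c]\<close>, and this fraction vanishes because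
  \<open>X\<^sub>n\<close> tends to infinity in probability (\<open>square_laplace_transform_tendsto\<close>).

  Finally, Laplace transforms at the positive integers determine weak convergence on the half-line: they
  are the moments of \<open>exp (-Y)\<close>, a random variable with values in \<open>[0, 1]\<close>, so that the Weierstrass
  approximation theorem applies (\<open>real_distribution_laplace_imp_weak_conv\<close>).
\<close>

section \<open>The heat function of the limiting Bessel process\<close>

text \<open>
  Up to a constant this is \<open>E exp (-l Y\<^sub>t\<^sup>2)\<close> with \<open>s = 1/l + 2 b t\<close>, for the Bessel process \<open>Y\<close>
  with drift \<open>\<mu>/x\<close> and diffusion coefficient \<open>b\<close>, started from \<open>x\<close>, where \<open>2 b k = 2 \<mu> + b\<close>.
\<close>

definition bessel_heat :: "real \<Rightarrow> real \<Rightarrow> real \<Rightarrow> real" where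
  "bessel_heat k s x = s powr (- k) * exp (- (x\<^sup>2 / s))"

lemma mult_exp_minus_le_1: "0 \<le> w \<Longrightarrow> w * exp (- w) \<le> (1::real)"
  using order_trans[OF _ exp_ge_add_one_self[of w], of w] by (simp add: exp_minus divide_simps)

lemma power2_mult_exp_minus_le_2:
  assumes "0 \<le> w" shows "w\<^sup>2 * exp (- w) \<le> (2::real)"
proof -
  have "w\<^sup>2 \<le> 2 * exp w"
    using exp_lower_Taylor_quadratic[OF assms] assms by simp
  then show ?thesis by (simp add: exp_minus field_simps)
qed

lemma abs_mult_exp_minus_square_le_1: "\<bar>u\<bar> * exp (- u\<^sup>2) \<le> (1::real)"
proof -
  have "\<bar>u\<bar> \<le> 1 + u\<^sup>2"
    using sum_squares_bound[of "\<bar>u\<bar>" 1] by simp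
  also have "\<dots> \<le> exp (u\<^sup>2)" by (rule exp_ge_add_one_self)
  finally show ?thesis by (simp add: exp_minus field_simps)
qed

lemma abs_cube_mult_exp_minus_square_le_1: "\<bar>u\<bar> ^ 3 * exp (- u\<^sup>2) \<le> (1::real)"
proof -
  have "2 * \<bar>u\<bar> ^ 3 \<le> u\<^sup>2 + (u\<^sup>2)\<^sup>2"
    using sum_squares_bound[of "\<bar>u\<bar>" "u\<^sup>2"] by (simp add: power2_eq_square power3_eq_cube abs_mult)
  also have "\<dots> \<le> 2 * exp (u\<^sup>2)"
    using exp_lower_Taylor_quadratic[of "u\<^sup>2"] zero_le_power2[of u] by argo
  finally show ?thesis by (simp add: exp_minus field_simps)
qed

text \<open>
  Both bounds on the Taylor remainder are needed: the quadratic one for large jumps, where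
  third moments need not exist, and the cubic one, which gains a factor \<open>\<bar>v\<bar>\<close>, for the others.
  Each follows from the Lagrange form, as the derivatives of the Gaussian are bounded.
\<close>

lemma gaussian_taylor:
  fixes u v :: real
  defines "R \<equiv> exp (- (u + v)\<^sup>2) - exp (- u\<^sup>2) * (1 - 2 * u * v + (2 * u\<^sup>2 - 1) * v\<^sup>2)"
  shows "\<bar>R\<bar> \<le> 4 * v\<^sup>2" "\<bar>R\<bar> \<le> 4 * \<bar>v\<bar> ^ 3"
proof -
  define d :: "nat \<Rightarrow> real \<Rightarrow> real" where
    "d m t = exp (- t\<^sup>2) *
      (if m = 0 then 1 else if m = 1 then - 2 * t else if m = 2 then 4 * t\<^sup>2 - 2
       else 12 * t - 8 * t ^ 3)" for m t
  have deriv: "DERIV (d m) t :> d (Suc m) t" if "m < 3" for m t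
  proof -
    from that consider "m = 0" | "m = 1" | "m = 2" by linarith
    then show ?thesis
      unfolding d_def
      by cases (auto intro!: derivative_eq_intros simp: algebra_simps power2_eq_square power3_eq_cube)
  qed
  have d0: "d 0 = (\<lambda>t. exp (- t\<^sup>2))"
    by (simp add: d_def fun_eq_iff)
  have d2: "\<bar>d 2 t\<bar> \<le> 4" for t
  proof -
    have "d 2 t = 4 * (t\<^sup>2 * exp (- t\<^sup>2)) - 2 * exp (- t\<^sup>2)"
      by (simp add: d_def algebra_simps)
    moreover have "0 \<le> t\<^sup>2 * exp (- t\<^sup>2)" "t\<^sup>2 * exp (- t\<^sup>2) \<le> 1"
      by (auto intro: mult_exp_minus_le_1)
    moreover have "0 \<le> exp (- t\<^sup>2)" "exp (- t\<^sup>2) \<le> 1" by auto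
    ultimately show ?thesis by linarith
  qed
  have d3: "\<bar>d 3 t\<bar> \<le> 20" for t
  proof -
    have "d 3 t = 12 * (t * exp (- t\<^sup>2)) - 8 * (t ^ 3 * exp (- t\<^sup>2))"
      by (simp add: d_def algebra_simps)
    moreover have "\<bar>t * exp (- t\<^sup>2)\<bar> \<le> 1" "\<bar>t ^ 3 * exp (- t\<^sup>2)\<bar> \<le> 1"
      using abs_mult_exp_minus_square_le_1[of t] abs_cube_mult_exp_minus_square_le_1[of t]
      by (auto simp: abs_mult power_abs)
    ultimately show ?thesis by linarith
  qed
  have main: "\<bar>R\<bar> \<le> 4 * v\<^sup>2 \<and> \<bar>R\<bar> \<le> 4 * \<bar>v\<bar> ^ 3"
  proof (cases "v = 0")
    case True then show ?thesis by (simp add: R_def)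
  next
    case False
    let ?a = "min u (u + v)" and ?b = "max u (u + v)"
    from Taylor[of 2 d "\<lambda>t. exp (- t\<^sup>2)" ?a ?b u "u + v"] deriv d0 False
    obtain t where t: "exp (- (u + v)\<^sup>2) = (\<Sum>m<2. d m u / fact m * v ^ m) + d 2 t / 2 * v\<^sup>2"
      by auto
    have R2: "R = (d 2 t - d 2 u) / 2 * v\<^sup>2"
      unfolding R_def t by (simp add: d_def numeral_2_eq_2 field_simps)
    have "\<bar>R\<bar> = \<bar>d 2 t - d 2 u\<bar> / 2 * v\<^sup>2"
      unfolding R2 by (simp add: abs_mult)
    moreover have "\<bar>d 2 t - d 2 u\<bar> / 2 \<le> 4" using d2[of t] d2[of u] abs_triangle_ineq4[of "d 2 t" "d 2 u"] by argo
    ultimately have 1: "\<bar>R\<bar> \<le> 4 * v\<^sup>2"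
      using mult_right_mono[of "\<bar>d 2 t - d 2 u\<bar> / 2" 4 "v\<^sup>2"] by simp
    from Taylor[of 3 d "\<lambda>t. exp (- t\<^sup>2)" ?a ?b u "u + v"] deriv d0 False
    obtain t where t: "exp (- (u + v)\<^sup>2) = (\<Sum>m<3. d m u / fact m * v ^ m) + d 3 t / 6 * v ^ 3"
      by (auto simp: fact_numeral)
    have R3: "R = d 3 t / 6 * v ^ 3"
      unfolding R_def t by (simp add: d_def numeral_3_eq_3 numeral_2_eq_2 field_simps)
    have "\<bar>R\<bar> = \<bar>d 3 t\<bar> / 6 * \<bar>v\<bar> ^ 3"
      unfolding R3 by (simp add: abs_mult power_abs)
    moreover have "\<bar>d 3 t\<bar> / 6 \<le> 4" using d3[of t] by linarith
    ultimately have "\<bar>R\<bar> \<le> 4 * \<bar>v\<bar> ^ 3"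
      using mult_right_mono[of "\<bar>d 3 t\<bar> / 6" 4 "\<bar>v\<bar> ^ 3"] by simp
    with 1 show ?thesis by simp
  qed
  from main show "\<bar>R\<bar> \<le> 4 * v\<^sup>2" "\<bar>R\<bar> \<le> 4 * \<bar>v\<bar> ^ 3" by auto
qed

text \<open>
  The previous bounds rescaled by \<open>sqrt s\<close>: a jump with \<open>z\<^sup>2 > K\<close> is charged quadratically, any other
  cubically with \<open>\<bar>z\<bar> \<le> sqrt K\<close>. For jumps with
  uniformly integrable squares, both terms on the right have small expectation, relative to \<open>1/s\<close>, once
  \<open>K\<close> and then \<open>s\<close> are large.
\<close>

lemma gaussian_taylor_truncated:
  fixes s K x z :: real
  assumes s: "s > 0" and K: "K \<ge> 0"
  shows "\<bar>exp (- ((x + z)\<^sup>2 / s))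
           - exp (- (x\<^sup>2 / s)) * (1 + (- 2 * (x * z) + (2 * (x\<^sup>2 / s) - 1) * z\<^sup>2) / s)\<bar>
         \<le> 4 / s * (z\<^sup>2 * indicator {t. t\<^sup>2 > K} z + sqrt K / sqrt s * z\<^sup>2)"
proof -
  define u v where "u = x / sqrt s" and "v = z / sqrt s"
  define R where "R = exp (- (u + v)\<^sup>2) - exp (- u\<^sup>2) * (1 - 2 * u * v + (2 * u\<^sup>2 - 1) * v\<^sup>2)"
  have sq: "(u + v)\<^sup>2 = (x + z)\<^sup>2 / s" "u\<^sup>2 = x\<^sup>2 / s" "v\<^sup>2 = z\<^sup>2 / s" "u * v = x * z / s"
    using s by (simp_all add: u_def v_def power_divide add_divide_distrib[symmetric])
  have "exp (- (x\<^sup>2 / s)) * (1 + (- 2 * (x * z) + (2 * (x\<^sup>2 / s) - 1) * z\<^sup>2) / s)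
      = exp (- u\<^sup>2) * (1 - 2 * u * v + (2 * u\<^sup>2 - 1) * v\<^sup>2)"
    using s by (simp add: sq mult.assoc diff_divide_distrib)
  then have "?thesis \<longleftrightarrow> \<bar>R\<bar> \<le> 4 / s * (z\<^sup>2 * indicator {t. t\<^sup>2 > K} z + sqrt K / sqrt s * z\<^sup>2)"
    by (simp only: R_def sq(1))
  moreover have "\<bar>R\<bar> \<le> 4 / s * (z\<^sup>2 * indicator {t. t\<^sup>2 > K} z + sqrt K / sqrt s * z\<^sup>2)"
  proof (cases "z\<^sup>2 > K")
    case True
    have "\<bar>R\<bar> \<le> 4 * v\<^sup>2" unfolding R_def by (rule gaussian_taylor)
    also have "\<dots> = 4 / s * z\<^sup>2" by (simp add: sq)
    also have "\<dots> \<le> 4 / s * (z\<^sup>2 * indicator {t. t\<^sup>2 > K} z + sqrt K / sqrt s * z\<^sup>2)"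
      using True s K by (intro mult_left_mono) auto
    finally show ?thesis .
  next
    case False
    have "\<bar>R\<bar> \<le> 4 * \<bar>v\<bar> ^ 3" unfolding R_def by (rule gaussian_taylor)
    also have "\<dots> = 4 * v\<^sup>2 * \<bar>v\<bar>" by (simp add: power2_eq_square power3_eq_cube)
    also have "\<dots> = 4 / s * z\<^sup>2 * (\<bar>z\<bar> / sqrt s)" using s by (simp add: sq) (simp add: v_def)
    also have "\<dots> \<le> 4 / s * z\<^sup>2 * (sqrt K / sqrt s)"
    proof (intro mult_left_mono divide_right_mono)
      show "\<bar>z\<bar> \<le> sqrt K" using False by (intro real_le_rsqrt) auto
    qed (use s in auto)
    also have "\<dots> \<le> 4 / s * (z\<^sup>2 * indicator {t. t\<^sup>2 > K} z + sqrt K / sqrt s * z\<^sup>2)"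
      using False by (simp add: mult.commute mult.left_commute)
    finally show ?thesis .
  qed
  ultimately show ?thesis by blast
qed

text \<open>
  Taylor expansion in the time variable. With \<open>w = x\<^sup>2/r\<close> the second derivative at \<open>r\<close> is
  \<open>r\<^sup>-\<^sup>k\<^sup>-\<^sup>2 ((w - k)\<^sup>2 - 2 w + k) exp (-w)\<close>, and a polynomial in \<open>w\<close> times
  \<open>exp (-w)\<close> is bounded, which makes the error uniform in \<open>x\<close>.
\<close>

lemma bessel_heat_time_step:
  fixes k \<theta> :: real
  assumes k: "k > 0" and \<theta>: "\<theta> > 0" and s: "s > 0"
  shows "\<bar>bessel_heat k (s + \<theta>) x - bessel_heat k s x * (1 + \<theta> / s * (x\<^sup>2 / s - k))\<bar>
         \<le> s powr (- k) * (\<theta>\<^sup>2 * (k\<^sup>2 + 3 * k + 4) / s\<^sup>2)"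
proof -
  define y where "y = x\<^sup>2"
  have y: "y \<ge> 0" by (simp add: y_def)
  define d :: "nat \<Rightarrow> real \<Rightarrow> real" where
    "d m r = r powr (- k) * exp (- (y / r)) *
      (if m = 0 then 1 else if m = 1 then y / r\<^sup>2 - k / r
       else ((y / r - k)\<^sup>2 - 2 * (y / r) + k) / r\<^sup>2)" for m r
  have deriv: "DERIV (d m) r :> d (Suc m) r" if m: "m < 2" and r: "s \<le> r" for m r
  proof -
    have r0: "r > 0" using r s by linarith
    have p: "r powr (- k - 1) = r powr (- k) / r"
      using r0 by (simp add: powr_diff)
    from m consider "m = 0" | "m = 1" by linarith
    then show ?thesis
      unfolding d_def using r0
      by cases (auto intro!: derivative_eq_intros simp: p field_simps power2_eq_square)
  qed
  have bound: "\<bar>d 2 r\<bar> \<le> s powr (- k) * (2 * (k\<^sup>2 + 3 * k + 4) / s\<^sup>2)" if r: "s \<le> r" for r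
  proof -
    have r0: "r > 0" using r s by linarith
    define w where "w = y / r"
    have w: "w \<ge> 0" using y r0 by (simp add: w_def)
    have "\<bar>((w - k)\<^sup>2 - 2 * w + k) * exp (- w)\<bar>
        = \<bar>w\<^sup>2 * exp (- w) - (2 * k + 2) * (w * exp (- w)) + (k\<^sup>2 + k) * exp (- w)\<bar>"
      by (simp add: algebra_simps power2_eq_square)
    also have "\<dots> \<le> \<bar>w\<^sup>2 * exp (- w)\<bar> + \<bar>(2 * k + 2) * (w * exp (- w))\<bar> + \<bar>(k\<^sup>2 + k) * exp (- w)\<bar>"
      by linarith
    also have "\<dots> \<le> 2 + (2 * k + 2) * 1 + (k\<^sup>2 + k) * 1"
      using w k mult_exp_minus_le_1[OF w] power2_mult_exp_minus_le_2[OF w]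
      unfolding abs_mult
      by (intro add_mono mult_mono) (auto simp: abs_mult)
    also have "\<dots> \<le> 2 * (k\<^sup>2 + 3 * k + 4)" using k by simp
    finally have 1: "\<bar>((w - k)\<^sup>2 - 2 * w + k) * exp (- w)\<bar> \<le> 2 * (k\<^sup>2 + 3 * k + 4)" .
    have "\<bar>d 2 r\<bar> = r powr (- k) * (\<bar>((w - k)\<^sup>2 - 2 * w + k) * exp (- w)\<bar> / r\<^sup>2)"
      using r0 by (simp add: d_def w_def abs_mult)
    also have "\<dots> \<le> s powr (- k) * (2 * (k\<^sup>2 + 3 * k + 4) / s\<^sup>2)"
      using k s r 1 by (intro mult_mono frac_le powr_mono2') (auto simp: power_mono)
    finally show ?thesis .
  qed
  have "d 0 = (\<lambda>r. r powr (- k) * exp (- (y / r)))" by (simp add: d_def fun_eq_iff)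
  from Taylor[of 2 d _ s "s + \<theta>" s "s + \<theta>", OF _ this] deriv \<theta>
  obtain t where t: "s < t" "t < s + \<theta>"
    "(s + \<theta>) powr (- k) * exp (- (y / (s + \<theta>))) = (\<Sum>m<2. d m s / fact m * \<theta> ^ m) + d 2 t / 2 * \<theta>\<^sup>2"
    by auto
  have "bessel_heat k (s + \<theta>) x - bessel_heat k s x * (1 + \<theta> / s * (x\<^sup>2 / s - k)) = d 2 t / 2 * \<theta>\<^sup>2"
  proof -
    have "(\<Sum>m<2. d m s / fact m * \<theta> ^ m) = d 0 s + d 1 s * \<theta>"
      by (simp add: numeral_2_eq_2)
    moreover have "d 0 s = bessel_heat k s x" "d 1 s = bessel_heat k s x * ((x\<^sup>2 / s - k) / s)"
      using s by (simp_all add: d_def bessel_heat_def y_def field_simps power2_eq_square)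
    ultimately have "bessel_heat k (s + \<theta>) x
        = bessel_heat k s x + bessel_heat k s x * ((x\<^sup>2 / s - k) / s) * \<theta> + d 2 t / 2 * \<theta>\<^sup>2"
      using t(3) by (simp only: bessel_heat_def[of k "s + \<theta>"] y_def)
    then show ?thesis by (simp add: algebra_simps diff_divide_distrib)
  qed
  also have "\<bar>\<dots>\<bar> \<le> (s powr (- k) * (2 * (k\<^sup>2 + 3 * k + 4) / s\<^sup>2)) / 2 * \<theta>\<^sup>2"
    unfolding abs_mult using bound[of t] t(1) by (intro mult_mono) (use k in auto)
  also have "\<dots> = s powr (- k) * (\<theta>\<^sup>2 * (k\<^sup>2 + 3 * k + 4) / s\<^sup>2)"
    using s by (simp add: field_simps)
  finally show ?thesis .
qed

text \<open>
  The two expansions combined. Because of \<open>2 b k = 2 \<mu> + b\<close> all terms of order \<open>s\<^sup>-\<^sup>k\<^sup>-\<^sup>1\<close> cancel,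
  except for those that measure how far \<open>x z\<close> and \<open>z\<^sup>2\<close> are from the limits \<open>\<mu>\<close> and \<open>b\<close> of their
  expectations.
\<close>

lemma bessel_heat_one_step:
  fixes k b \<mu> :: real
  assumes k: "k > 0" and b: "b > 0" and kb: "2 * b * k = 2 * \<mu> + b"
    and s: "s > 0" and K: "K \<ge> 0"
  shows "\<bar>bessel_heat k s (x + z) - bessel_heat k (s + 2 * b) x
           - s powr (- k) / s * exp (- (x\<^sup>2 / s))
               * (- 2 * (x * z - \<mu>) + (2 * (x\<^sup>2 / s) - 1) * (z\<^sup>2 - b))\<bar>
         \<le> s powr (- k) / s * (4 * (z\<^sup>2 * indicator {t. t\<^sup>2 > K} z) + 4 * sqrt K / sqrt s * z\<^sup>2
              + (2 * b)\<^sup>2 * (k\<^sup>2 + 3 * k + 4) / s)"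
proof -
  define g where "g = exp (- (x\<^sup>2 / s))"
  define A where "A = exp (- ((x + z)\<^sup>2 / s))
      - g * (1 + (- 2 * (x * z) + (2 * (x\<^sup>2 / s) - 1) * z\<^sup>2) / s)"
  define B where "B = bessel_heat k (s + 2 * b) x - bessel_heat k s x * (1 + 2 * b / s * (x\<^sup>2 / s - k))"
  have \<mu>: "\<mu> = b * k - b / 2" using kb by simp
  have "bessel_heat k s (x + z) - bessel_heat k (s + 2 * b) x
      - s powr (- k) / s * g * (- 2 * (x * z - \<mu>) + (2 * (x\<^sup>2 / s) - 1) * (z\<^sup>2 - b))
    = s powr (- k) * A - B"
    unfolding A_def B_def bessel_heat_def g_def[symmetric] \<mu> using s
    by (simp add: field_simps)
  also have "\<bar>\<dots>\<bar> \<le> \<bar>s powr (- k) * A\<bar> + \<bar>B\<bar>" by linarith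
  also have "\<dots> \<le> s powr (- k) * (4 / s * (z\<^sup>2 * indicator {t. t\<^sup>2 > K} z + sqrt K / sqrt s * z\<^sup>2))
      + s powr (- k) * ((2 * b)\<^sup>2 * (k\<^sup>2 + 3 * k + 4) / s\<^sup>2)"
  proof (rule add_mono)
    have "\<bar>A\<bar> \<le> 4 / s * (z\<^sup>2 * indicator {t. t\<^sup>2 > K} z + sqrt K / sqrt s * z\<^sup>2)"
      using gaussian_taylor_truncated[OF s K, of x z] by (simp add: A_def g_def)
    then show "\<bar>s powr (- k) * A\<bar>
        \<le> s powr (- k) * (4 / s * (z\<^sup>2 * indicator {t. t\<^sup>2 > K} z + sqrt K / sqrt s * z\<^sup>2))"
      unfolding abs_mult by (simp add: mult_left_mono del: times_divide_eq_left times_divide_eq_right)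
    show "\<bar>B\<bar> \<le> s powr (- k) * ((2 * b)\<^sup>2 * (k\<^sup>2 + 3 * k + 4) / s\<^sup>2)"
      unfolding B_def using bessel_heat_time_step[OF k _ s, of "2 * b" x] b by simp
  qed
  also have "\<dots> = s powr (- k) / s * (4 * (z\<^sup>2 * indicator {t. t\<^sup>2 > K} z) + 4 * sqrt K / sqrt s * z\<^sup>2
              + (2 * b)\<^sup>2 * (k\<^sup>2 + 3 * k + 4) / s)"
    using s by (simp add: field_simps power2_eq_square)
  finally show ?thesis unfolding g_def .
qed

section \<open>Uniform integrability from a stochastic majorant\<close>

text \<open>
  The layer cake formula for the truncated tail: for \<open>t \<ge> 0\<close>, the truncated variable exceeds \<open>t\<close> exactly
  if \<open>f\<close> exceeds both \<open>t\<close> and \<open>K\<close>. The right-hand side thus depends only on the tail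
  probabilities, which are what a stochastic order compares.
\<close>

lemma nn_integral_truncated_layer_cake:
  fixes f :: "'a \<Rightarrow> real"
  assumes "sigma_finite_measure M" and f[measurable]: "f \<in> borel_measurable M" and K: "K \<ge> 0"
  shows "(\<integral>\<^sup>+\<omega>. ennreal (f \<omega> * indicator {K<..} (f \<omega>)) \<partial>M)
       = (\<integral>\<^sup>+t. indicator {0..} t * emeasure M {\<omega> \<in> space M. f \<omega> > max t K} \<partial>lborel)"
proof -
  interpret sigma_finite_measure M by fact
  interpret P: pair_sigma_finite M lborel ..
  have "ennreal (f \<omega> * indicator {K<..} (f \<omega>))
      = (\<integral>\<^sup>+t. indicator {0..} t * indicator {\<omega>. f \<omega> > max t K} \<omega> \<partial>lborel)" for \<omega>
  proof -
    have "ennreal (f \<omega> * indicator {K<..} (f \<omega>))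
        = emeasure lborel {t. 0 \<le> t \<and> t < f \<omega> * indicator {K<..} (f \<omega>)}"
    proof -
      have "{t. 0 \<le> t \<and> t < f \<omega> * indicator {K<..} (f \<omega>)} = {0..<f \<omega> * indicator {K<..} (f \<omega>)}"
        by auto
      moreover have "0 \<le> f \<omega> * indicator {K<..} (f \<omega>)"
        using K by (auto simp: indicator_def)
      ultimately show ?thesis by simp
    qed
    also have "\<dots> = (\<integral>\<^sup>+t. indicator {t. 0 \<le> t \<and> t < f \<omega> * indicator {K<..} (f \<omega>)} t \<partial>lborel)"
      by simp
    also have "\<dots> = (\<integral>\<^sup>+t. indicator {0..} t * indicator {\<omega>. f \<omega> > max t K} \<omega> \<partial>lborel)"
      using K by (intro nn_integral_cong) (auto simp: indicator_def split: if_splits)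
    finally show ?thesis .
  qed
  then have "(\<integral>\<^sup>+\<omega>. ennreal (f \<omega> * indicator {K<..} (f \<omega>)) \<partial>M)
      = (\<integral>\<^sup>+\<omega>. \<integral>\<^sup>+t. indicator {0..} t * indicator {\<omega>. f \<omega> > max t K} \<omega> \<partial>lborel \<partial>M)"
    by simp
  also have "\<dots> = (\<integral>\<^sup>+t. \<integral>\<^sup>+\<omega>. indicator {0..} t * indicator {\<omega>. f \<omega> > max t K} \<omega> \<partial>M \<partial>lborel)"
    by (rule P.Fubini'[symmetric]) (simp add: indicator_def)
  also have "\<dots> = (\<integral>\<^sup>+t. indicator {0..} t * emeasure M {\<omega> \<in> space M. f \<omega> > max t K} \<partial>lborel)"
  proof (intro nn_integral_cong)
    fix t :: real
    have "(\<integral>\<^sup>+\<omega>. indicator {0..} t * indicator {\<omega>. f \<omega> > max t K} \<omega> \<partial>M)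
        = (\<integral>\<^sup>+\<omega>. indicator {0..} t * indicator {\<omega> \<in> space M. f \<omega> > max t K} \<omega> \<partial>M)"
      by (intro nn_integral_cong) (simp add: indicator_def)
    then show "(\<integral>\<^sup>+\<omega>. indicator {0..} t * indicator {\<omega>. f \<omega> > max t K} \<omega> \<partial>M)
        = indicator {0..} t * emeasure M {\<omega> \<in> space M. f \<omega> > max t K}"
      by (simp add: nn_integral_cmult_indicator)
  qed
  finally show ?thesis .
qed

lemma st_le_nn_integral_tail_mono:
  fixes Y :: "'a \<Rightarrow> real" and Z :: "'b \<Rightarrow> real"
  assumes M: "prob_space M" and N: "prob_space N"
    and Y: "Y \<in> borel_measurable M" and Z: "Z \<in> borel_measurable N"
    and st: "st_le M Y N Z" and K: "K \<ge> 0"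
  shows "(\<integral>\<^sup>+\<omega>. ennreal (Y \<omega> * indicator {K<..} (Y \<omega>)) \<partial>M)
       \<le> (\<integral>\<^sup>+\<omega>. ennreal (Z \<omega> * indicator {K<..} (Z \<omega>)) \<partial>N)"
proof -
  interpret M: prob_space M by fact
  interpret N: prob_space N by fact
  have le: "emeasure M {\<omega> \<in> space M. Y \<omega> > t} \<le> emeasure N {\<omega> \<in> space N. Z \<omega> > t}" for t
    using st by (simp add: st_le_def M.emeasure_eq_measure N.emeasure_eq_measure)
  then show ?thesis
    unfolding nn_integral_truncated_layer_cake[OF M.sigma_finite_measure_axioms Y K]
      nn_integral_truncated_layer_cake[OF N.sigma_finite_measure_axioms Z K]
    by (intro nn_integral_mono mult_left_mono le) auto
qed

lemma integral_tail_tendsto_0: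
  fixes Z :: "'b \<Rightarrow> real"
  assumes Z: "integrable N Z"
  shows "((\<lambda>K. \<integral>\<omega>. Z \<omega> * indicator {K<..} (Z \<omega>) \<partial>N) \<longlongrightarrow> 0) at_top"
proof -
  have "((\<lambda>K. \<integral>\<omega>. Z \<omega> * indicator {K<..} (Z \<omega>) \<partial>N) \<longlongrightarrow> (\<integral>\<omega>. 0 \<partial>N)) at_top"
  proof (rule integral_dominated_convergence_at_top[where w = "\<lambda>\<omega>. \<bar>Z \<omega>\<bar>"])
    show "AE \<omega> in N. ((\<lambda>K. Z \<omega> * indicator {K<..} (Z \<omega>)) \<longlongrightarrow> 0) at_top"
    proof (intro AE_I2 tendsto_eventually)
      fix \<omega>
      show "\<forall>\<^sub>F K in at_top. Z \<omega> * indicator {K<..} (Z \<omega>) = 0"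
        using eventually_ge_at_top[of "Z \<omega>"] by eventually_elim simp
    qed
  qed (use Z in \<open>auto simp: indicator_def\<close>)
  then show ?thesis by simp
qed

text \<open>
  A single integrable majorant makes a family of nonnegative random variables uniformly integrable. With
  \<open>K = 0\<close> the second statement bounds the expectation of \<open>Y\<close>.
\<close>

lemma st_le_integrable_tail:
  fixes Y :: "'a \<Rightarrow> real" and Z :: "'b \<Rightarrow> real"
  assumes M: "prob_space M" and N: "prob_space N"
    and Y[measurable]: "Y \<in> borel_measurable M" and Z: "integrable N Z"
    and Y0: "\<And>\<omega>. Y \<omega> \<ge> 0"
    and st: "st_le M Y N Z" and K: "K \<ge> 0"
  shows "integrable M Y"
    and "(\<integral>\<omega>. Y \<omega> * indicator {K<..} (Y \<omega>) \<partial>M) \<le> (\<integral>\<omega>. Z \<omega> * indicator {K<..} (Z \<omega>) \<partial>N)"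
proof -
  have [measurable]: "Z \<in> borel_measurable N" using Z by simp
  have le: "(\<integral>\<^sup>+\<omega>. ennreal (Y \<omega> * indicator {L<..} (Y \<omega>)) \<partial>M)
      \<le> ennreal (\<integral>\<omega>. Z \<omega> * indicator {L<..} (Z \<omega>) \<partial>N)" if L: "L \<ge> 0" for L
  proof -
    have "integrable N (\<lambda>\<omega>. Z \<omega> * indicator {L<..} (Z \<omega>))"
      by (rule Bochner_Integration.integrable_bound[OF Z]) (auto simp: indicator_def)
    moreover have "0 \<le> Z \<omega> * indicator {L<..} (Z \<omega>)" for \<omega>
      using L by (auto simp: indicator_def)
    ultimately show ?thesis
      using st_le_nn_integral_tail_mono[OF M N Y _ st L] by (simp add: nn_integral_eq_integral)
  qed
  have Y': "Y \<omega> * indicator {0<..} (Y \<omega>) = Y \<omega>" for \<omega>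
    using Y0[of \<omega>] by (auto simp: indicator_def)
  show int: "integrable M Y"
  proof (rule integrableI_nonneg)
    show "(\<integral>\<^sup>+\<omega>. ennreal (Y \<omega>) \<partial>M) < \<infinity>"
      using le[of 0] by (simp add: Y' order.strict_trans1)
  qed (use Y0 in auto)
  have "integrable M (\<lambda>\<omega>. Y \<omega> * indicator {K<..} (Y \<omega>))"
    by (rule Bochner_Integration.integrable_bound[OF int]) (auto simp: indicator_def)
  moreover have "0 \<le> Y \<omega> * indicator {K<..} (Y \<omega>)" for \<omega>
    using Y0[of \<omega>] by (auto simp: indicator_def)
  moreover have "0 \<le> (\<integral>\<omega>. Z \<omega> * indicator {K<..} (Z \<omega>) \<partial>N)"
    using K by (intro integral_nonneg_AE) (auto simp: indicator_def)
  ultimately show "(\<integral>\<omega>. Y \<omega> * indicator {K<..} (Y \<omega>) \<partial>M) \<le> (\<integral>\<omega>. Z \<omega> * indicator {K<..} (Z \<omega>) \<partial>N)"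
    using le[OF K] by (simp add: nn_integral_eq_integral)
qed

section \<open>Approximate space-time harmonicity along the chain\<close>

lemma bessel_heat_nonneg: "0 \<le> bessel_heat k s x"
  by (simp add: bessel_heat_def)

lemma bessel_heat_le: "s > 0 \<Longrightarrow> bessel_heat k s x \<le> s powr (- k)"
  by (simp add: bessel_heat_def mult_left_le)

lemma bessel_heat_measurable[measurable]: "bessel_heat k s \<in> borel_measurable borel"
  unfolding bessel_heat_def by measurable

text \<open>
  In expectation \<open>x z - \<mu>\<close> and \<open>z\<^sup>2 - b\<close> become the deviations of the first two moments from their
  limits. Their coefficients \<open>2 exp (-w)\<close> and \<open>(2 w - 1) exp (-w)\<close>, with \<open>w = x\<^sup>2/s\<close>, are bounded
  by \<open>2\<close>.
\<close>

lemma bessel_heat_one_step_expectation: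
  fixes k b \<mu> :: real
  assumes k: "k > 0" and b: "b > 0" and kb: "2 * b * k = 2 * \<mu> + b"
    and s: "s > 0" and K: "K \<ge> 0"
    and J: "prob_space J" and sets_J[measurable_cong]: "sets J = sets borel"
    and sq: "integrable J (\<lambda>z. z\<^sup>2)"
  shows "\<bar>(\<integral>z. bessel_heat k s (x + z) \<partial>J) - bessel_heat k (s + 2 * b) x\<bar>
         \<le> s powr (- k) / s * (2 * \<bar>x * (\<integral>z. z \<partial>J) - \<mu>\<bar> + 2 * \<bar>(\<integral>z. z\<^sup>2 \<partial>J) - b\<bar>
              + 4 * (\<integral>z. z\<^sup>2 * indicator {K<..} (z\<^sup>2) \<partial>J) + 4 * sqrt K / sqrt s * (\<integral>z. z\<^sup>2 \<partial>J)
              + (2 * b)\<^sup>2 * (k\<^sup>2 + 3 * k + 4) / s)"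
proof -
  interpret J: prob_space J by fact
  define p where "p = s powr (- k) / s"
  have p: "p \<ge> 0" using s by (simp add: p_def)
  define g w where "g = exp (- (x\<^sup>2 / s))" and "w = x\<^sup>2 / s"
  define C where "C = (2 * b)\<^sup>2 * (k\<^sup>2 + 3 * k + 4) / s"
  define Q where "Q z = z\<^sup>2 * indicator {K<..} (z\<^sup>2)" for z :: real
  define L where "L z = p * g * (- 2 * (x * z - \<mu>) + (2 * w - 1) * (z\<^sup>2 - b))" for z
  define E where "E z = p * (4 * Q z + 4 * sqrt K / sqrt s * z\<^sup>2 + C)" for z
  have id: "integrable J (\<lambda>z. z)"
    using J.square_integrable_imp_integrable[of "\<lambda>z. z"] sq by simp
  have Q: "integrable J Q"
    unfolding Q_def by (rule Bochner_Integration.integrable_bound[OF sq]) (auto simp: indicator_def)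
  have heat: "integrable J (\<lambda>z. bessel_heat k s (x + z))"
    by (rule J.integrable_const_bound[where B = "s powr (- k)"])
       (use bessel_heat_le[OF s] bessel_heat_nonneg in \<open>auto simp: abs_of_nonneg\<close>)
  have L: "integrable J L" and EL: "(\<integral>z. L z \<partial>J) =
      p * g * (- 2 * (x * (\<integral>z. z \<partial>J) - \<mu>) + (2 * w - 1) * ((\<integral>z. z\<^sup>2 \<partial>J) - b))"
    unfolding L_def using id sq by (auto simp: J.prob_space)
  have E: "integrable J E" and EE: "(\<integral>z. E z \<partial>J) =
      p * (4 * (\<integral>z. Q z \<partial>J) + 4 * sqrt K / sqrt s * (\<integral>z. z\<^sup>2 \<partial>J) + C)"
    unfolding E_def using Q sq by (auto simp: J.prob_space)
  have step: "\<bar>bessel_heat k s (x + z) - bessel_heat k (s + 2 * b) x - L z\<bar> \<le> E z" for z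
    using bessel_heat_one_step[OF k b kb s K, of x z]
    by (simp add: L_def E_def p_def g_def w_def C_def Q_def indicator_def)
  have "\<bar>(\<integral>z. bessel_heat k s (x + z) \<partial>J) - bessel_heat k (s + 2 * b) x - (\<integral>z. L z \<partial>J)\<bar>
      = \<bar>\<integral>z. bessel_heat k s (x + z) - bessel_heat k (s + 2 * b) x - L z \<partial>J\<bar>"
    using heat L by (simp add: J.prob_space)
  also have "\<dots> \<le> (\<integral>z. \<bar>bessel_heat k s (x + z) - bessel_heat k (s + 2 * b) x - L z\<bar> \<partial>J)"
    by (rule integral_abs_bound)
  also have "\<dots> \<le> (\<integral>z. E z \<partial>J)"
    using heat L E step by (intro integral_mono) auto
  finally have 1: "\<bar>(\<integral>z. bessel_heat k s (x + z) \<partial>J) - bessel_heat k (s + 2 * b) x - (\<integral>z. L z \<partial>J)\<bar> \<le> (\<integral>z. E z \<partial>J)" .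
  have "\<bar>\<integral>z. L z \<partial>J\<bar> \<le> p * (2 * \<bar>x * (\<integral>z. z \<partial>J) - \<mu>\<bar> + 2 * \<bar>(\<integral>z. z\<^sup>2 \<partial>J) - b\<bar>)"
  proof -
    have g: "0 \<le> g" "g \<le> 1" using s by (auto simp: g_def)
    have w: "w \<ge> 0" using s by (simp add: w_def)
    have "0 \<le> w * g" "w * g \<le> 1" using mult_exp_minus_le_1[OF w] g w by (auto simp: g_def w_def[symmetric])
    moreover have "g * (2 * w - 1) = 2 * (w * g) - g" by (simp add: algebra_simps)
    ultimately have gw: "\<bar>g * (2 * w - 1)\<bar> \<le> 2" using g by linarith
    have "(\<integral>z. L z \<partial>J) = p * (g * (- 2 * (x * (\<integral>z. z \<partial>J) - \<mu>)) + g * (2 * w - 1) * ((\<integral>z. z\<^sup>2 \<partial>J) - b))"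
      unfolding EL by (simp add: algebra_simps)
    also have "\<bar>\<dots>\<bar> \<le> p * (\<bar>g * (- 2 * (x * (\<integral>z. z \<partial>J) - \<mu>))\<bar> + \<bar>g * (2 * w - 1) * ((\<integral>z. z\<^sup>2 \<partial>J) - b)\<bar>)"
      using p by (subst abs_mult) (simp add: mult_left_mono abs_triangle_ineq)
    also have "\<dots> \<le> p * (1 * \<bar>- 2 * (x * (\<integral>z. z \<partial>J) - \<mu>)\<bar> + 2 * \<bar>(\<integral>z. z\<^sup>2 \<partial>J) - b\<bar>)"
      unfolding abs_mult[of g "- 2 * (x * (\<integral>z. z \<partial>J) - \<mu>)"] abs_mult[of "g * (2 * w - 1)"]
      using p g gw by (intro mult_left_mono add_mono mult_right_mono) auto
    also have "\<dots> = p * (2 * \<bar>x * (\<integral>z. z \<partial>J) - \<mu>\<bar> + 2 * \<bar>(\<integral>z. z\<^sup>2 \<partial>J) - b\<bar>)"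
      by (simp only: mult_1 abs_mult abs_minus_cancel abs_numeral)
    finally show ?thesis .
  qed
  with 1 have "\<bar>(\<integral>z. bessel_heat k s (x + z) \<partial>J) - bessel_heat k (s + 2 * b) x\<bar>
      \<le> p * (2 * \<bar>x * (\<integral>z. z \<partial>J) - \<mu>\<bar> + 2 * \<bar>(\<integral>z. z\<^sup>2 \<partial>J) - b\<bar>) + (\<integral>z. E z \<partial>J)"
    by linarith
  also have "\<dots> = p * (2 * \<bar>x * (\<integral>z. z \<partial>J) - \<mu>\<bar> + 2 * \<bar>(\<integral>z. z\<^sup>2 \<partial>J) - b\<bar>
      + 4 * (\<integral>z. Q z \<partial>J) + 4 * sqrt K / sqrt s * (\<integral>z. z\<^sup>2 \<partial>J) + C)"
    unfolding EE by (simp only: distrib_left add.assoc)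
  finally show ?thesis unfolding p_def Q_def C_def .
qed

text \<open>
  The constants depend on \<open>\<epsilon>\<close> but neither on \<open>s\<close> nor on \<open>x\<close>. The majorant fixes a truncation level \<open>K\<close>
  for the large jumps, then \<open>c\<close> is a point beyond which the first two moments are close to their limits,
  and \<open>R\<close> makes the terms that decay in \<open>s\<close> small. For \<open>x \<le> c\<close> the moments are only known to be bounded,
  which costs the constant \<open>D\<close>.
\<close>

lemma uniform_bessel_heat_one_step:
  fixes J :: "real \<Rightarrow> real measure" and N :: "'b measure" and \<Xi> :: "'b \<Rightarrow> real"
  assumes k: "k > 0" and b: "b > 0" and kb: "2 * b * k = 2 * \<mu> + b"
    and J: "\<And>x. x \<ge> 0 \<Longrightarrow> prob_space (J x)" and sets_J: "\<And>x. x \<ge> 0 \<Longrightarrow> sets (J x) = sets borel"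
    and drift: "((\<lambda>x. x * (\<integral>z. z \<partial>J x)) \<longlongrightarrow> \<mu>) at_top"
    and second_moment: "((\<lambda>x. \<integral>z. z\<^sup>2 \<partial>J x) \<longlongrightarrow> b) at_top"
    and N: "prob_space N" and \<Xi>: "integrable N \<Xi>"
    and majorant: "\<And>x. x \<ge> 0 \<Longrightarrow> st_le (J x) (\<lambda>z. z\<^sup>2) N \<Xi>"
    and \<epsilon>: "\<epsilon> > 0"
  shows "\<exists>c R D. R > 0 \<and> D \<ge> 0 \<and> (\<forall>s\<ge>R. \<forall>x\<ge>0.
       \<bar>(\<integral>z. bessel_heat k s (x + z) \<partial>J x) - bessel_heat k (s + 2 * b) x\<bar>
       \<le> s powr (- k) / s * (\<epsilon> + D * indicator {..c} x))"
proof -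
  define T where "T K = (\<integral>\<omega>. \<Xi> \<omega> * indicator {K<..} (\<Xi> \<omega>) \<partial>N)" for K :: real
  define C where "C = (2 * b)\<^sup>2 * (k\<^sup>2 + 3 * k + 4)"
  have tail: "integrable (J x) (\<lambda>z. z\<^sup>2)"
    "(\<integral>z. z\<^sup>2 * indicator {K<..} (z\<^sup>2) \<partial>J x) \<le> T K" if x: "x \<ge> 0" and K: "K \<ge> 0" for x K
  proof -
    have "(\<lambda>z. z\<^sup>2) \<in> borel_measurable (J x)"
      using sets_J[OF x] by (simp cong: measurable_cong_sets)
    from st_le_integrable_tail[OF J[OF x] N this \<Xi> _ majorant[OF x] K]
    show "integrable (J x) (\<lambda>z. z\<^sup>2)" "(\<integral>z. z\<^sup>2 * indicator {K<..} (z\<^sup>2) \<partial>J x) \<le> T K"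
      by (auto simp: T_def)
  qed
  have sq: "(\<integral>z. z\<^sup>2 \<partial>J x) \<le> T 0" if x: "x \<ge> 0" for x
  proof -
    have "(\<integral>z. z\<^sup>2 * indicator {0<..} (z\<^sup>2) \<partial>J x) = (\<integral>z. z\<^sup>2 \<partial>J x)"
      by (intro Bochner_Integration.integral_cong) (auto simp: indicator_def)
    then show ?thesis using tail(2)[OF x, of 0] by simp
  qed
  have sq0: "0 \<le> (\<integral>z. z\<^sup>2 \<partial>J x)" for x by simp
  have T0: "0 \<le> T 0" using order_trans[OF sq0 sq[of 0]] by simp
  have mean: "\<bar>\<integral>z. z \<partial>J x\<bar> \<le> 1 + T 0" if x: "x \<ge> 0" for x
  proof -
    interpret J: prob_space "J x" by (rule J[OF x])
    have [measurable]: "(\<lambda>z. z) \<in> borel_measurable (J x)"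
      using sets_J[OF x] by (simp cong: measurable_cong_sets)
    have "\<bar>\<integral>z. z \<partial>J x\<bar> \<le> (\<integral>z. \<bar>z\<bar> \<partial>J x)" by (rule integral_abs_bound)
    also have "\<dots> \<le> (\<integral>z. 1 + z\<^sup>2 \<partial>J x)"
    proof (rule integral_mono)
      show "integrable (J x) (\<lambda>z. \<bar>z\<bar>)"
        using J.square_integrable_imp_integrable[of "\<lambda>z. z"] tail(1)[OF x order_refl] by simp
      show "integrable (J x) (\<lambda>z. 1 + z\<^sup>2)" using tail(1)[OF x order_refl] by simp
      show "\<bar>z\<bar> \<le> 1 + z\<^sup>2" for z :: real using sum_squares_bound[of "\<bar>z\<bar>" 1] by simp
    qed
    also have "\<dots> = 1 + (\<integral>z. z\<^sup>2 \<partial>J x)" using tail(1)[OF x order_refl] by (simp add: J.prob_space)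
    finally show ?thesis using sq[OF x] by simp
  qed
  \<comment> \<open>The coefficients \<open>2\<close> and \<open>4\<close> in the one-step bound turn these thresholds into multiples of \<open>\<epsilon> / 5\<close>.\<close>
  have "\<forall>\<^sub>F K in at_top. T K < \<epsilon> / 20"
    using order_tendstoD(2)[OF integral_tail_tendsto_0[OF \<Xi>], of "\<epsilon> / 20"] \<epsilon> by (simp add: T_def)
  with eventually_ge_at_top[of "0 :: real"] have "\<forall>\<^sub>F K in at_top. K \<ge> 0 \<and> T K < \<epsilon> / 20"
    by eventually_elim simp
  then obtain K where K: "K \<ge> 0" "T K < \<epsilon> / 20"
    by (auto simp: eventually_at_top_linorder)
  have "\<forall>\<^sub>F x in at_top. dist (x * (\<integral>z. z \<partial>J x)) \<mu> < \<epsilon> / 10 \<and> dist (\<integral>z. z\<^sup>2 \<partial>J x) b < \<epsilon> / 10"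
    using \<epsilon> by (intro eventually_conj tendstoD[OF drift] tendstoD[OF second_moment]) auto
  then obtain c0 where c0: "\<And>x. x \<ge> c0 \<Longrightarrow>
      dist (x * (\<integral>z. z \<partial>J x)) \<mu> < \<epsilon> / 10 \<and> dist (\<integral>z. z\<^sup>2 \<partial>J x) b < \<epsilon> / 10"
    by (auto simp: eventually_at_top_linorder)
  define c where "c = max c0 0"
  have "((\<lambda>s. 4 * sqrt K / sqrt s * T 0 + C / s) \<longlongrightarrow> 4 * sqrt K * 0 * T 0 + 0) at_top"
    by real_asymp
  then have "\<forall>\<^sub>F s in at_top. 4 * sqrt K / sqrt s * T 0 + C / s < \<epsilon> / 5"
    using \<epsilon> by (intro order_tendstoD(2)) auto
  then obtain R0 where R0: "\<And>s. s \<ge> R0 \<Longrightarrow> 4 * sqrt K / sqrt s * T 0 + C / s < \<epsilon> / 5"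
    by (auto simp: eventually_at_top_linorder)
  define R where "R = max R0 1"
  \<comment> \<open>On \<open>[0, c]\<close> the moment deviations are bounded via \<open>\<bar>z\<bar> \<le> 1 + z\<^sup>2\<close> and the majorant.\<close>
  define D where "D = 2 * (c * (1 + T 0) + \<bar>\<mu>\<bar>) + 2 * (T 0 + b)"
  show ?thesis
  proof (intro exI conjI allI impI)
    show "R > 0" by (simp add: R_def)
    show "D \<ge> 0" using T0 b by (auto simp: D_def c_def intro!: add_nonneg_nonneg mult_nonneg_nonneg)
    fix s x :: real assume s: "s \<ge> R" and x: "x \<ge> 0"
    have s0: "s > 0" using s by (simp add: R_def)
    have err: "2 * \<bar>x * (\<integral>z. z \<partial>J x) - \<mu>\<bar> + 2 * \<bar>(\<integral>z. z\<^sup>2 \<partial>J x) - b\<bar>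
        \<le> 2 * (\<epsilon> / 5) + D * indicator {..c} x"
    proof (cases "x \<le> c")
      case True
      have "\<bar>x * (\<integral>z. z \<partial>J x)\<bar> \<le> c * (1 + T 0)"
        unfolding abs_mult using True x mean[OF x] by (intro mult_mono) auto
      moreover have "\<bar>(\<integral>z. z\<^sup>2 \<partial>J x) - b\<bar> \<le> T 0 + b"
        using sq[OF x] sq0[of x] b T0 by linarith
      ultimately have "2 * \<bar>x * (\<integral>z. z \<partial>J x) - \<mu>\<bar> + 2 * \<bar>(\<integral>z. z\<^sup>2 \<partial>J x) - b\<bar> \<le> D"
        using abs_triangle_ineq4[of "x * (\<integral>z. z \<partial>J x)" \<mu>] unfolding D_def by argo
      then show ?thesis using True \<epsilon> by simp
    next
      case False
      then have "c0 \<le> x" by (simp add: c_def)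
      from c0[OF this] have "\<bar>x * (\<integral>z. z \<partial>J x) - \<mu>\<bar> < \<epsilon> / 10" "\<bar>(\<integral>z. z\<^sup>2 \<partial>J x) - b\<bar> < \<epsilon> / 10"
        by (auto simp: dist_real_def)
      moreover have "indicator {..c} x = (0 :: real)" using False by simp
      ultimately show ?thesis by simp
    qed
    have "4 * (\<integral>z. z\<^sup>2 * indicator {K<..} (z\<^sup>2) \<partial>J x) \<le> \<epsilon> / 5"
      using tail(2)[OF x K(1)] K(2) by simp
    moreover have "4 * sqrt K / sqrt s * (\<integral>z. z\<^sup>2 \<partial>J x) + C / s \<le> \<epsilon> / 5"
    proof -
      have "4 * sqrt K / sqrt s * (\<integral>z. z\<^sup>2 \<partial>J x) \<le> 4 * sqrt K / sqrt s * T 0"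
        using K s0 sq[OF x] by (intro mult_left_mono) auto
      then show ?thesis using R0[of s] s by (simp add: R_def)
    qed
    ultimately have "2 * \<bar>x * (\<integral>z. z \<partial>J x) - \<mu>\<bar> + 2 * \<bar>(\<integral>z. z\<^sup>2 \<partial>J x) - b\<bar>
        + 4 * (\<integral>z. z\<^sup>2 * indicator {K<..} (z\<^sup>2) \<partial>J x) + 4 * sqrt K / sqrt s * (\<integral>z. z\<^sup>2 \<partial>J x) + C / s
        \<le> \<epsilon> + D * indicator {..c} x"
      using err \<epsilon> by linarith
    then have "s powr (- k) / s * (2 * \<bar>x * (\<integral>z. z \<partial>J x) - \<mu>\<bar> + 2 * \<bar>(\<integral>z. z\<^sup>2 \<partial>J x) - b\<bar>
        + 4 * (\<integral>z. z\<^sup>2 * indicator {K<..} (z\<^sup>2) \<partial>J x) + 4 * sqrt K / sqrt s * (\<integral>z. z\<^sup>2 \<partial>J x) + C / s)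
        \<le> s powr (- k) / s * (\<epsilon> + D * indicator {..c} x)"
      using s0 by (intro mult_left_mono) auto
    then show "\<bar>(\<integral>z. bessel_heat k s (x + z) \<partial>J x) - bessel_heat k (s + 2 * b) x\<bar>
        \<le> s powr (- k) / s * (\<epsilon> + D * indicator {..c} x)"
      using bessel_heat_one_step_expectation[OF k b kb s0 K(1) J[OF x] sets_J[OF x] tail(1)[OF x order_refl], of x]
      unfolding C_def by linarith
  qed
qed

section \<open>One-step expectations of a Markov chain\<close>

context markov_chain
begin

lemma subalgebra_natural_filtration: "subalgebra M (natural_filtration M S X n)"
proof -
  let ?G = "\<Union>i\<in>{..n}. {X i -` A \<inter> space M | A. A \<in> sets S}"
  have "?G \<subseteq> sets M"
    using random_variable_X by (auto intro: measurable_sets)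
  then have "sigma_sets (space M) ?G \<subseteq> sets M"
    by (rule sets.sigma_sets_subset)
  moreover have "?G \<subseteq> Pow (space M)" by auto
  ultimately show ?thesis
    unfolding subalgebra_def natural_filtration_def
    by (simp add: sets_measure_of)
qed

lemma prob_space_kernel: "x \<in> space S \<Longrightarrow> prob_space (P x)"
  and sets_kernel: "x \<in> space S \<Longrightarrow> sets (P x) = sets S"
  using measurable_space[OF kernel] by (auto simp: space_prob_algebra)

text \<open>
  Taking expectations in the Markov property removes the conditioning: it is through the
  evolution of its marginal laws that the chain enters the telescoping argument.
\<close>

lemma distr_Suc: "distr M S (X (Suc n)) = distr M S (X n) \<bind> P"
proof (rule measure_eqI)
  have ne: "space (distr M S (X n)) \<noteq> {}"
    using measurable_space[OF random_variable_X[of n]] not_empty by auto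
  have K: "P \<in> distr M S (X n) \<rightarrow>\<^sub>M subprob_algebra S"
    using measurable_prob_algebraD[OF kernel] by simp
  show "sets (distr M S (X (Suc n))) = sets (distr M S (X n) \<bind> P)"
    using sets_kernel ne by (subst sets_bind[where N = S]) auto
  fix D assume "D \<in> sets (distr M S (X (Suc n)))"
  then have D: "D \<in> sets S" by simp
  interpret F: finite_measure_subalgebra M "natural_filtration M S X n"
    by unfold_locales (rule subalgebra_natural_filtration)
  have [measurable]: "X m \<in> M \<rightarrow>\<^sub>M S" for m by (rule random_variable_X)
  have m1[measurable]: "(\<lambda>x. measure (P x) D) \<in> borel_measurable S"
    by (rule measurable_compose[OF kernel measurable_measure_prob_algebra[OF D]])
  have int: "integrable M (\<lambda>\<omega>. indicator D (X (Suc n) \<omega>) :: real)"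
    using D by (intro integrable_const_bound[where B = 1]) auto
  have "emeasure (distr M S (X (Suc n))) D = ennreal (\<integral>\<omega>. indicat_real D (X (Suc n) \<omega>) \<partial>M)"
  proof -
    have "(\<integral>\<omega>. indicat_real D (X (Suc n) \<omega>) \<partial>M) = (\<integral>\<omega>. indicator (X (Suc n) -` D \<inter> space M) \<omega> \<partial>M)"
      by (intro Bochner_Integration.integral_cong) (auto simp: indicator_def)
    then show ?thesis using D by (simp add: emeasure_distr emeasure_eq_measure)
  qed
  also have "(\<integral>\<omega>. indicat_real D (X (Suc n) \<omega>) \<partial>M)
      = (\<integral>\<omega>. real_cond_exp M (natural_filtration M S X n) (\<lambda>\<omega>'. indicator D (X (Suc n) \<omega>')) \<omega> \<partial>M)"
    using F.real_cond_exp_int(2)[OF int] by simp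
  also have "\<dots> = (\<integral>\<omega>. measure (P (X n \<omega>)) D \<partial>M)"
    using markov_property[OF D, of n] by (intro integral_cong_AE) auto
  also have "ennreal \<dots> = (\<integral>\<^sup>+\<omega>. ennreal (measure (P (X n \<omega>)) D) \<partial>M)"
  proof (rule nn_integral_eq_integral[symmetric])
    show "integrable M (\<lambda>\<omega>. measure (P (X n \<omega>)) D)"
    proof (rule integrable_const_bound[where B = 1])
      show "AE \<omega> in M. norm (measure (P (X n \<omega>)) D) \<le> 1"
        using prob_space.prob_le_1[OF prob_space_kernel] measurable_space[OF random_variable_X]
        by (intro AE_I2) auto
    qed measurable
  qed auto
  also have "\<dots> = (\<integral>\<^sup>+\<omega>. emeasure (P (X n \<omega>)) D \<partial>M)"
  proof (intro nn_integral_cong)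
    fix \<omega> assume "\<omega> \<in> space M"
    then interpret Px: prob_space "P (X n \<omega>)"
      by (intro prob_space_kernel measurable_space[OF random_variable_X])
    show "ennreal (measure (P (X n \<omega>)) D) = emeasure (P (X n \<omega>)) D"
      by (simp add: Px.emeasure_eq_measure)
  qed
  also have "\<dots> = (\<integral>\<^sup>+x. emeasure (P x) D \<partial>distr M S (X n))"
    using measurable_prob_algebraD[OF kernel] D
    by (subst nn_integral_distr) (auto intro: measurable_emeasure_kernel)
  also have "\<dots> = emeasure (distr M S (X n) \<bind> P) D"
    by (rule emeasure_bind[OF ne K D, symmetric])
  finally show "emeasure (distr M S (X (Suc n))) D = emeasure (distr M S (X n) \<bind> P) D" .
qed

lemma expectation_Suc:
  fixes f :: "'s \<Rightarrow> real"
  assumes f[measurable]: "f \<in> borel_measurable S" and f0: "\<And>x. f x \<ge> 0" and fB: "\<And>x. f x \<le> B"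
  shows "integrable M (\<lambda>\<omega>. \<integral>y. f y \<partial>P (X n \<omega>))"
    and "expectation (\<lambda>\<omega>. f (X (Suc n) \<omega>)) = expectation (\<lambda>\<omega>. \<integral>y. f y \<partial>P (X n \<omega>))"
proof -
  have [measurable]: "X m \<in> M \<rightarrow>\<^sub>M S" for m by (rule random_variable_X)
  have [measurable]: "P \<in> S \<rightarrow>\<^sub>M subprob_algebra S" by (rule measurable_prob_algebraD[OF kernel])
  have inner: "(\<integral>\<^sup>+y. ennreal (f y) \<partial>P x) = ennreal (\<integral>y. f y \<partial>P x)"
    "0 \<le> (\<integral>y. f y \<partial>P x)" "(\<integral>y. f y \<partial>P x) \<le> B" if x: "x \<in> space S" for x
  proof -
    interpret Px: prob_space "P x" by (rule prob_space_kernel[OF x])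
    have m: "f \<in> borel_measurable (P x)" using sets_kernel[OF x] f by (simp cong: measurable_cong_sets)
    have i: "integrable (P x) f"
      using m f0 fB by (intro Px.integrable_const_bound[where B = B]) auto
    show "(\<integral>\<^sup>+y. ennreal (f y) \<partial>P x) = ennreal (\<integral>y. f y \<partial>P x)"
      by (rule nn_integral_eq_integral[OF i]) (use f0 in auto)
    show "0 \<le> (\<integral>y. f y \<partial>P x)" using f0 by simp
    show "(\<integral>y. f y \<partial>P x) \<le> B" using Px.integral_le_const[OF i] fB by auto
  qed
  have sp: "X m \<omega> \<in> space S" if "\<omega> \<in> space M" for m \<omega>
    using measurable_space[OF random_variable_X that] .
  have meas: "(\<lambda>x. \<integral>y. f y \<partial>P x) \<in> borel_measurable S"
  proof -
    have "(\<lambda>x. enn2real (\<integral>\<^sup>+y. ennreal (f y) \<partial>P x)) \<in> borel_measurable S"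
      by measurable
    then show ?thesis
      by (rule measurable_cong[THEN iffD1, rotated]) (simp add: inner)
  qed
  show int: "integrable M (\<lambda>\<omega>. \<integral>y. f y \<partial>P (X n \<omega>))"
    using meas inner sp
    by (intro integrable_const_bound[where B = B]) (auto intro!: AE_I2 measurable_compose[OF random_variable_X])
  have "ennreal (expectation (\<lambda>\<omega>. f (X (Suc n) \<omega>))) = (\<integral>\<^sup>+\<omega>. ennreal (f (X (Suc n) \<omega>)) \<partial>M)"
    using f0 fB by (intro nn_integral_eq_integral[symmetric] integrable_const_bound[where B = B]) auto
  also have "\<dots> = (\<integral>\<^sup>+x. ennreal (f x) \<partial>distr M S (X (Suc n)))"
    by (subst nn_integral_distr) auto
  also have "\<dots> = (\<integral>\<^sup>+x. \<integral>\<^sup>+y. ennreal (f y) \<partial>P x \<partial>distr M S (X n))"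
    unfolding distr_Suc by (rule nn_integral_bind[where B = S]) auto
  also have "\<dots> = (\<integral>\<^sup>+\<omega>. \<integral>\<^sup>+y. ennreal (f y) \<partial>P (X n \<omega>) \<partial>M)"
    by (subst nn_integral_distr) auto
  also have "\<dots> = (\<integral>\<^sup>+\<omega>. ennreal (\<integral>y. f y \<partial>P (X n \<omega>)) \<partial>M)"
    using inner sp by (intro nn_integral_cong) auto
  also have "\<dots> = ennreal (expectation (\<lambda>\<omega>. \<integral>y. f y \<partial>P (X n \<omega>)))"
    by (intro nn_integral_eq_integral int AE_I2 inner(2) sp)
  finally have "ennreal (expectation (\<lambda>\<omega>. f (X (Suc n) \<omega>)))
      = ennreal (expectation (\<lambda>\<omega>. \<integral>y. f y \<partial>P (X n \<omega>)))" .
  moreover have "0 \<le> expectation (\<lambda>\<omega>. f (X (Suc n) \<omega>))" using f0 by simp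
  moreover have "0 \<le> expectation (\<lambda>\<omega>. \<integral>y. f y \<partial>P (X n \<omega>))"
    by (intro integral_nonneg_AE AE_I2 inner(2) sp)
  ultimately show "expectation (\<lambda>\<omega>. f (X (Suc n) \<omega>)) = expectation (\<lambda>\<omega>. \<integral>y. f y \<partial>P (X n \<omega>))"
    by simp
qed

end

section \<open>Convergence of the Laplace transform\<close>

lemma cesaro_mean_tendsto_0:
  fixes f :: "nat \<Rightarrow> real"
  assumes f: "f \<longlonglongrightarrow> 0"
  shows "(\<lambda>n. (\<Sum>j<n. f j) / real n) \<longlonglongrightarrow> 0"
proof (rule LIMSEQ_I)
  fix e :: real assume e: "0 < e"
  from f have "Bseq f" by (intro convergent_imp_Bseq convergentI)
  then obtain B where B: "B > 0" "\<And>j. \<bar>f j\<bar> \<le> B" by (auto elim: BseqE)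
  from LIMSEQ_D[OF f, of "e / 2"] e obtain N where N: "\<And>j. j \<ge> N \<Longrightarrow> \<bar>f j\<bar> < e / 2" by auto
  obtain n0 :: nat where n0: "real n0 > 2 * (real N * B) / e" using reals_Archimedean2 by blast
  show "\<exists>no. \<forall>n\<ge>no. norm ((\<Sum>j<n. f j) / real n - 0) < e"
  proof (intro exI allI impI)
    fix n assume n: "n \<ge> max n0 1"
    have "\<bar>\<Sum>j<n. f j\<bar> \<le> (\<Sum>j<n. \<bar>f j\<bar>)" by (rule sum_abs)
    also have "\<dots> \<le> (\<Sum>j<n. (if j < N then B else 0) + e / 2)"
    proof (rule sum_mono)
      fix j
      show "\<bar>f j\<bar> \<le> (if j < N then B else 0) + e / 2"
        using B(2)[of j] N[of j] e by (cases "j < N") auto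
    qed
    also have "\<dots> = (\<Sum>j<n. if j < N then B else 0) + real n * (e / 2)"
      by (simp add: sum.distrib)
    also have "(\<Sum>j<n. if j < N then B else 0) = real (card {j. j < n \<and> j < N}) * B"
      by (simp add: sum.If_cases Int_def)
    also have "\<dots> \<le> real N * B"
      using B card_mono[of "{..<N}" "{j. j < n \<and> j < N}"] by (intro mult_right_mono) auto
    also have "real N * B < real n * (e / 2)"
    proof -
      have "2 * (real N * B) < real n0 * e" using n0 e by (simp add: pos_divide_less_eq)
      also have "\<dots> \<le> real n * e" using n e by (intro mult_right_mono) auto
      finally show ?thesis by simp
    qed
    finally have "\<bar>\<Sum>j<n. f j\<bar> < e * real n" by (simp add: mult.commute)
    then show "norm ((\<Sum>j<n. f j) / real n - 0) < e"
      using n by (simp add: field_simps)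
  qed
qed

text \<open>
  The telescoping argument. At step \<open>j\<close> the time parameter is \<open>s\<^sub>j = n/l + 2 b (n - j)\<close>, so that
  \<open>(n/l)\<^sup>k bessel_heat k s\<^sub>j X\<^sub>j\<close> interpolates between a quantity with limit \<open>(1 + 2 b l)\<^sup>-\<^sup>k\<close> at \<open>j = 0\<close>
  and \<open>exp (-l X\<^sub>n\<^sup>2/n)\<close> at \<open>j = n\<close>.
\<close>

lemma square_laplace_transform_tendsto:
  fixes M :: "'a measure" and N :: "'b measure"
  assumes chain: "markov_chain M nonneg_reals P X"
    and b: "b > 0" and k: "k > 0" and kb: "2 * b * k = 2 * \<mu> + b"
    and drift: "((\<lambda>x. x * (\<integral>z. z \<partial>jump_law P x)) \<longlongrightarrow> \<mu>) at_top"
    and second_moment: "((\<lambda>x. \<integral>z. z\<^sup>2 \<partial>jump_law P x) \<longlongrightarrow> b) at_top"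
    and N: "prob_space N" and \<Xi>: "integrable N \<Xi>"
    and majorant: "\<And>x. x \<ge> 0 \<Longrightarrow> st_le (jump_law P x) (\<lambda>z. z\<^sup>2) N \<Xi>"
    and to_infinity: "\<And>c. (\<lambda>n. measure M {\<omega> \<in> space M. X n \<omega> > c}) \<longlonglongrightarrow> 1"
    and l: "l > 0"
  shows "(\<lambda>n. \<integral>\<omega>. exp (- (l * ((X n \<omega>)\<^sup>2 / real n))) \<partial>M) \<longlonglongrightarrow> (1 + 2 * b * l) powr (- k)"
proof -
  interpret markov_chain M nonneg_reals P X by fact
  have space_S: "space nonneg_reals = {0..}"
    by (simp add: nonneg_reals_def space_restrict_space)
  have X_nonneg: "X n \<omega> \<ge> 0" if "\<omega> \<in> space M" for n \<omega>
    using measurable_space[OF random_variable_X that] by (simp add: space_S)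
  have X_borel[measurable]: "X n \<in> borel_measurable M" for n
    using random_variable_X[of n] by (simp add: nonneg_reals_def measurable_restrict_space2_iff)
  have borel_S: "f \<in> borel_measurable nonneg_reals" if "f \<in> borel_measurable borel" for f :: "real \<Rightarrow> real"
    unfolding nonneg_reals_def by (rule measurable_restrict_space1[OF that])
  have shift: "(\<lambda>y. y - x) \<in> P x \<rightarrow>\<^sub>M borel" if "x \<ge> 0" for x
  proof -
    have "(\<lambda>y. y - x) \<in> borel_measurable nonneg_reals" by (rule borel_S) simp
    then show ?thesis using sets_kernel[of x] that by (simp add: space_S cong: measurable_cong_sets)
  qed
  have J: "prob_space (jump_law P x)" "sets (jump_law P x) = sets borel" if "x \<ge> 0" for x
    using prob_space.prob_space_distr[OF prob_space_kernel shift] that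
    by (auto simp: jump_law_def space_S)
  have kernel_heat: "(\<integral>y. bessel_heat k s y \<partial>P x) = (\<integral>z. bessel_heat k s (x + z) \<partial>jump_law P x)"
    if "x \<ge> 0" for s x
    unfolding jump_law_def by (subst integral_distr[OF shift[OF that]]) auto

  \<comment> \<open>\<open>V0\<close> and \<open>V1\<close> are the expectations at the two ends of the interpolation.\<close>
  define q where "q n = real n / l" for n :: nat
  define a where "a n = q n powr k" for n
  define V0 where "V0 n = expectation (\<lambda>\<omega>. a n * bessel_heat k (q n + 2 * b * real n) (X 0 \<omega>))" for n
  define V1 where "V1 n = expectation (\<lambda>\<omega>. a n * bessel_heat k (q n) (X n \<omega>))" for n
  have a0: "a n \<ge> 0" for n unfolding a_def by (rule powr_ge_zero)
  have q0: "q n > 0" if "n \<ge> 1" for n using l that by (simp add: q_def)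

  have V1: "V1 n = (\<integral>\<omega>. exp (- (l * ((X n \<omega>)\<^sup>2 / real n))) \<partial>M)" if n: "n \<ge> 1" for n
    unfolding V1_def using q0[OF n] n
    by (intro Bochner_Integration.integral_cong)
       (auto simp: a_def bessel_heat_def powr_minus q_def field_simps)
  have heat0: "a n * bessel_heat k (q n + 2 * b * real n) x
      = (1 + 2 * b * l) powr (- k) * exp (- (x\<^sup>2 / (real n * (1 / l + 2 * b))))" if n: "n \<ge> 1" for n x
  proof -
    have e: "q n + 2 * b * real n = q n * (1 + 2 * b * l)" "q n + 2 * b * real n = real n * (1 / l + 2 * b)"
      using l by (simp_all add: q_def field_simps)
    have "(q n + 2 * b * real n) powr (- k) = q n powr (- k) * (1 + 2 * b * l) powr (- k)"
      unfolding e(1) by (rule powr_mult)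
    then have "a n * (q n + 2 * b * real n) powr (- k) = (1 + 2 * b * l) powr (- k)"
      using q0[OF n] by (simp add: a_def powr_minus)
    then show ?thesis unfolding bessel_heat_def e(2)[symmetric] by (simp add: mult.assoc[symmetric])
  qed
  have V0: "V0 \<longlonglongrightarrow> (1 + 2 * b * l) powr (- k)"
  proof -
    have "(\<lambda>n. expectation (\<lambda>\<omega>. exp (- ((X 0 \<omega>)\<^sup>2 / (real n * (1 / l + 2 * b)))))) \<longlonglongrightarrow> expectation (\<lambda>\<omega>. 1)"
    proof (rule integral_dominated_convergence[where w = "\<lambda>_. 1"])
      show "AE \<omega> in M. (\<lambda>n. exp (- ((X 0 \<omega>)\<^sup>2 / (real n * (1 / l + 2 * b))))) \<longlonglongrightarrow> 1"
      proof (intro AE_I2)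
        fix \<omega>
        have "(\<lambda>n. exp (- ((X 0 \<omega>)\<^sup>2 / (1 / l + 2 * b) * inverse (real n)))) \<longlonglongrightarrow> exp (- ((X 0 \<omega>)\<^sup>2 / (1 / l + 2 * b) * 0))"
          by (intro tendsto_intros LIMSEQ_inverse_real_of_nat lim_inverse_n)
        then show "(\<lambda>n. exp (- ((X 0 \<omega>)\<^sup>2 / (real n * (1 / l + 2 * b))))) \<longlonglongrightarrow> 1"
          by (simp add: divide_inverse mult.assoc mult.commute mult.left_commute)
      qed
      show "AE \<omega> in M. norm (exp (- ((X 0 \<omega>)\<^sup>2 / (real n * (1 / l + 2 * b))))) \<le> 1" for n
        using l b by (intro AE_I2) auto
    qed auto
    from tendsto_mult_left[OF this, of "(1 + 2 * b * l) powr (- k)"]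
    have "(\<lambda>n. (1 + 2 * b * l) powr (- k) * expectation (\<lambda>\<omega>. exp (- ((X 0 \<omega>)\<^sup>2 / (real n * (1 / l + 2 * b))))))
        \<longlonglongrightarrow> (1 + 2 * b * l) powr (- k)"
      by (simp add: prob_space)
    moreover have "\<forall>\<^sub>F n in sequentially. (1 + 2 * b * l) powr (- k)
        * expectation (\<lambda>\<omega>. exp (- ((X 0 \<omega>)\<^sup>2 / (real n * (1 / l + 2 * b))))) = V0 n"
      using eventually_ge_at_top[of 1] by eventually_elim (simp add: V0_def heat0)
    ultimately show ?thesis by (rule Lim_transform_eventually)
  qed

  have "(\<lambda>n. V1 n - V0 n) \<longlonglongrightarrow> 0"
  proof (rule LIMSEQ_I)
    fix e :: real assume e: "e > 0"
    \<comment> \<open>The accumulated error is \<open>l * \<epsilon>\<close> plus a null sequence, hence eventually below \<open>e\<close>.\<close>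
    define \<epsilon> where "\<epsilon> = e / (2 * l)"
    have \<epsilon>: "\<epsilon> > 0" using e l by (simp add: \<epsilon>_def)
    obtain c R D where R: "R > 0" and D: "D \<ge> 0" and step:
      "\<And>s x. s \<ge> R \<Longrightarrow> x \<ge> 0 \<Longrightarrow>
        \<bar>(\<integral>z. bessel_heat k s (x + z) \<partial>jump_law P x) - bessel_heat k (s + 2 * b) x\<bar>
        \<le> s powr (- k) / s * (\<epsilon> + D * indicator {..c} x)"
      using uniform_bessel_heat_one_step[OF k b kb J drift second_moment N \<Xi> majorant \<epsilon>] by metis
    define f where "f n = prob {\<omega> \<in> space M. X n \<omega> \<le> c}" for n
    have f: "f n = 1 - prob {\<omega> \<in> space M. X n \<omega> > c}" for n
    proof -
      have "{\<omega> \<in> space M. X n \<omega> \<le> c} = space M - {\<omega> \<in> space M. X n \<omega> > c}" by auto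
      then show ?thesis unfolding f_def by (simp add: prob_compl)
    qed
    have "f \<longlonglongrightarrow> 0"
      using tendsto_diff[OF tendsto_const[of 1] to_infinity[of c]] by (simp add: f[abs_def])
    then have cesaro: "(\<lambda>n. (\<Sum>j<n. f j) / real n) \<longlonglongrightarrow> 0" by (rule cesaro_mean_tendsto_0)
    have expectation_step: "\<bar>expectation (\<lambda>\<omega>. bessel_heat k s (X (Suc j) \<omega>)) - expectation (\<lambda>\<omega>. bessel_heat k (s + 2 * b) (X j \<omega>))\<bar>
        \<le> s powr (- k) / s * (\<epsilon> + D * f j)" if s: "s \<ge> R" for s j
    proof -
      have s0: "s > 0" using s R by simp
      let ?E = "\<lambda>\<omega>. \<integral>y. bessel_heat k s y \<partial>P (X j \<omega>)" and ?H = "\<lambda>\<omega>. bessel_heat k (s + 2 * b) (X j \<omega>)"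
      let ?I = "indicator {\<omega> \<in> space M. X j \<omega> \<le> c} :: _ \<Rightarrow> real"
      have E: "integrable M ?E" "expectation (\<lambda>\<omega>. bessel_heat k s (X (Suc j) \<omega>)) = expectation ?E"
        using expectation_Suc[of "bessel_heat k s" "s powr (- k)" j, OF borel_S[OF bessel_heat_measurable] bessel_heat_nonneg bessel_heat_le[OF s0]]
        by auto
      have H: "integrable M ?H"
        by (rule integrable_const_bound[where B = "(s + 2 * b) powr (- k)"])
           (use s0 b bessel_heat_nonneg bessel_heat_le in \<open>auto simp: abs_of_nonneg\<close>)
      have I: "integrable M ?I"
        by (rule integrable_const_bound[where B = 1]) auto
      have "\<bar>expectation ?E - expectation ?H\<bar> = \<bar>expectation (\<lambda>\<omega>. ?E \<omega> - ?H \<omega>)\<bar>"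
        using E(1) H by simp
      also have "\<dots> \<le> expectation (\<lambda>\<omega>. \<bar>?E \<omega> - ?H \<omega>\<bar>)" by (rule integral_abs_bound)
      also have "\<dots> \<le> expectation (\<lambda>\<omega>. s powr (- k) / s * (\<epsilon> + D * ?I \<omega>))"
      proof (rule integral_mono)
        show "integrable M (\<lambda>\<omega>. \<bar>?E \<omega> - ?H \<omega>\<bar>)" using E(1) H by simp
        show "integrable M (\<lambda>\<omega>. s powr (- k) / s * (\<epsilon> + D * ?I \<omega>))"
          by (intro integrable_mult_right Bochner_Integration.integrable_add I) simp
        fix \<omega> assume \<omega>: "\<omega> \<in> space M"
        show "\<bar>?E \<omega> - ?H \<omega>\<bar> \<le> s powr (- k) / s * (\<epsilon> + D * ?I \<omega>)"
          using step[OF s X_nonneg[OF \<omega>]] \<omega> by (simp add: kernel_heat X_nonneg indicator_def)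
      qed
      also have "\<dots> = s powr (- k) / s * (\<epsilon> + D * f j)"
        using I by (simp add: f_def prob_space)
      finally show ?thesis unfolding E(2) .
    qed
    have bound: "\<bar>V1 n - V0 n\<bar> \<le> l * (\<epsilon> + D * ((\<Sum>j<n. f j) / real n))"
      if n: "n \<ge> 1" and qR: "q n \<ge> R" for n
    proof -
      define s where "s j = q n + 2 * b * (real n - real j)" for j
      define h where "h j = expectation (\<lambda>\<omega>. bessel_heat k (s j) (X j \<omega>))" for j
      have "h n - h 0 = (\<Sum>j<n. h (Suc j) - h j)" by (rule sum_lessThan_telescope[symmetric])
      also have "\<bar>\<dots>\<bar> \<le> (\<Sum>j<n. \<bar>h (Suc j) - h j\<bar>)" by (rule sum_abs)
      also have "\<dots> \<le> (\<Sum>j<n. q n powr (- k) / q n * (\<epsilon> + D * f j))"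
      proof (rule sum_mono)
        fix j assume "j \<in> {..<n}"
        then have j: "real j + 1 \<le> real n" by simp
        have sq: "q n \<le> s (Suc j)" using j b by (simp add: s_def)
        have "s j = s (Suc j) + 2 * b" by (simp add: s_def algebra_simps)
        then have "\<bar>h (Suc j) - h j\<bar> \<le> s (Suc j) powr (- k) / s (Suc j) * (\<epsilon> + D * f j)"
          using expectation_step[of "s (Suc j)" j] sq qR by (simp add: h_def)
        also have "\<dots> \<le> q n powr (- k) / q n * (\<epsilon> + D * f j)"
          using sq q0[OF n] \<epsilon> D k
          by (intro mult_right_mono frac_le powr_mono2') (auto simp: f_def)
        finally show "\<bar>h (Suc j) - h j\<bar> \<le> q n powr (- k) / q n * (\<epsilon> + D * f j)" .
      qed
      also have "\<dots> = q n powr (- k) / q n * (real n * \<epsilon> + D * (\<Sum>j<n. f j))"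
      proof -
        have "(\<Sum>j<n. \<epsilon> + D * f j) = real n * \<epsilon> + D * (\<Sum>j<n. f j)"
          by (simp add: sum.distrib sum_distrib_left)
        then show ?thesis by (simp only: sum_distrib_left[symmetric])
      qed
      finally have "a n * \<bar>h n - h 0\<bar> \<le> a n * (q n powr (- k) / q n * (real n * \<epsilon> + D * (\<Sum>j<n. f j)))"
        using a0 by (rule mult_left_mono)
      also have "\<dots> = l * (\<epsilon> + D * ((\<Sum>j<n. f j) / real n))"
        using q0[OF n] n l by (simp add: a_def powr_minus) (simp add: q_def field_simps)
      also have "a n * \<bar>h n - h 0\<bar> = \<bar>V1 n - V0 n\<bar>"
        unfolding V1_def V0_def h_def s_def
        using a0[of n] by (simp add: abs_mult right_diff_distrib[symmetric])
      finally show ?thesis .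
    qed
    have "(\<lambda>n. l * (\<epsilon> + D * ((\<Sum>j<n. f j) / real n))) \<longlonglongrightarrow> l * (\<epsilon> + D * 0)"
      by (intro tendsto_intros cesaro)
    then have "\<forall>\<^sub>F n in sequentially. l * (\<epsilon> + D * ((\<Sum>j<n. f j) / real n)) < e"
      by (rule order_tendstoD(2)) (use e l in \<open>simp add: \<epsilon>_def\<close>)
    moreover have "filterlim q at_top sequentially"
      unfolding q_def using l by real_asymp
    then have "\<forall>\<^sub>F n in sequentially. q n \<ge> R"
      by (simp add: filterlim_at_top)
    ultimately have "\<forall>\<^sub>F n in sequentially. norm (V1 n - V0 n - 0) < e"
      using eventually_ge_at_top[of 1]
    proof eventually_elim
      case (elim n)
      then show ?case using bound[of n] by simp
    qed
    then show "\<exists>no. \<forall>n\<ge>no. norm (V1 n - V0 n - 0) < e"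
      by (simp add: eventually_sequentially)
  qed
  from tendsto_add[OF this V0] have "V1 \<longlonglongrightarrow> (1 + 2 * b * l) powr (- k)" by simp
  moreover have "\<forall>\<^sub>F n in sequentially. V1 n = (\<integral>\<omega>. exp (- (l * ((X n \<omega>)\<^sup>2 / real n))) \<partial>M)"
    using eventually_ge_at_top[of 1] by eventually_elim (rule V1)
  ultimately show ?thesis by (rule Lim_transform_eventually)
qed

section \<open>Weak convergence from Laplace transforms\<close>

text \<open>
  For \<open>y \<ge> 0\<close> the variable \<open>w = exp (-y)\<close> lies in \<open>[0, 1]\<close>. The step functions that test weak convergence
  vanish near infinity, hence are continuous functions of \<open>w\<close> up to and including \<open>w = 0\<close>, and
  polynomials in \<open>w\<close> approximate them uniformly. The expectations of these polynomials
  are linear combinations of Laplace transforms at natural numbers.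
\<close>

lemma real_distribution_laplace_imp_weak_conv:
  fixes \<nu> :: "nat \<Rightarrow> real measure" and \<nu>' :: "real measure"
  assumes \<nu>: "\<And>n. real_distribution (\<nu> n)" and \<nu>': "real_distribution \<nu>'"
    and pos: "\<And>n. AE y in \<nu> n. 0 \<le> y" and pos': "AE y in \<nu>'. 0 \<le> y"
    and laplace: "\<And>m. m \<ge> 1 \<Longrightarrow>
      (\<lambda>n. \<integral>y. exp (- (real m * y)) \<partial>\<nu> n) \<longlonglongrightarrow> (\<integral>y. exp (- (real m * y)) \<partial>\<nu>')"
  shows "weak_conv_m \<nu> \<nu>'"
proof (rule integral_cts_step_conv_imp_weak_conv[OF \<nu> \<nu>'])
  fix x y :: real assume xy: "x < y"
  \<comment> \<open>As a function of \<open>w\<close> the step is zero up to \<open>exp (-y)\<close>; cutting off there avoids the logarithm at \<open>0\<close>.\<close>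
  define g where "g w = cts_step x y (- ln (max w (exp (- y))))" for w
  have "continuous_on UNIV (cts_step x y)"
    using cts_step_uniformly_continuous[OF xy] by (rule uniformly_continuous_imp_continuous)
  then have "continuous_on {0..1} g"
    unfolding g_def
  proof (rule continuous_on_compose2)
    have "max w (exp (- y)) > 0" for w by (simp add: less_max_iff_disj)
    then have "max w (exp (- y)) \<noteq> 0" for w by (metis less_irrefl)
    then show "continuous_on {0..1} (\<lambda>w. - ln (max w (exp (- y))))"
      by (intro continuous_intros) auto
  qed simp
  have step_eq: "cts_step x y t = g (exp (- t))" for t
    using xy by (auto simp: g_def max_def cts_step_def)
  show "(\<lambda>n. \<integral>t. cts_step x y t \<partial>\<nu> n) \<longlonglongrightarrow> (\<integral>t. cts_step x y t \<partial>\<nu>')"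
  proof (rule LIMSEQ_I)
    fix e :: real assume e: "e > 0"
    obtain p where "real_polynomial_function p" and p: "\<And>w. w \<in> {0..1} \<Longrightarrow> \<bar>g w - p w\<bar> < e / 4"
      using Stone_Weierstrass_real_polynomial_function[OF _ \<open>continuous_on {0..1} g\<close>, of "e / 4"] e
      by auto
    then obtain a d where a: "p = (\<lambda>w. \<Sum>i\<le>d. a i * w ^ i)"
      by (auto simp: real_polynomial_function_iff_sum)
    define I where "I \<kappa> = (\<Sum>i\<le>d. a i * (\<integral>t. exp (- (real i * t)) \<partial>\<kappa>))" for \<kappa> :: "real measure"
    have approx: "\<bar>(\<integral>t. cts_step x y t \<partial>\<kappa>) - I \<kappa>\<bar> \<le> e / 4"
      if \<kappa>: "real_distribution \<kappa>" and AE: "AE t in \<kappa>. 0 \<le> t" for \<kappa>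
    proof -
      interpret real_distribution \<kappa> by fact
      have int: "integrable \<kappa> (\<lambda>t. exp (- (real i * t)))" for i
        by (rule integrable_const_bound[where B = 1]) (use AE in \<open>auto elim: AE_mp\<close>)
      have pI: "integrable \<kappa> (\<lambda>t. p (exp (- t)))" "(\<integral>t. p (exp (- t)) \<partial>\<kappa>) = I \<kappa>"
        unfolding a I_def using int by (auto simp: exp_of_nat_mult[symmetric])
      have "\<bar>(\<integral>t. cts_step x y t \<partial>\<kappa>) - I \<kappa>\<bar> = \<bar>\<integral>t. cts_step x y t - p (exp (- t)) \<partial>\<kappa>\<bar>"
        using pI integrable_cts_step[OF xy] by simp
      also have "\<dots> \<le> (\<integral>t. \<bar>cts_step x y t - p (exp (- t))\<bar> \<partial>\<kappa>)" by (rule integral_abs_bound)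
      also have "\<dots> \<le> (\<integral>t. e / 4 \<partial>\<kappa>)"
      proof (rule integral_mono_AE)
        show "AE t in \<kappa>. \<bar>cts_step x y t - p (exp (- t))\<bar> \<le> e / 4"
          using AE
        proof eventually_elim
          fix t :: real assume "0 \<le> t"
          then show "\<bar>cts_step x y t - p (exp (- t))\<bar> \<le> e / 4"
            using p[of "exp (- t)"] by (simp add: step_eq)
        qed
      qed (use pI integrable_cts_step[OF xy] in auto)
      finally show ?thesis using prob_space by simp
    qed
    have "(\<lambda>n. I (\<nu> n)) \<longlonglongrightarrow> I \<nu>'"
      unfolding I_def
    proof (intro tendsto_intros)
      fix i assume "i \<in> {..d}"
      show "(\<lambda>n. \<integral>t. exp (- (real i * t)) \<partial>\<nu> n) \<longlonglongrightarrow> (\<integral>t. exp (- (real i * t)) \<partial>\<nu>')"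
      proof (cases "i = 0")
        case True
        have "measure \<kappa> (space \<kappa>) = 1" if "real_distribution \<kappa>" for \<kappa>
          using that by (simp add: real_distribution_def prob_space.prob_space)
        then show ?thesis using True \<nu> \<nu>' by simp
      qed (use laplace in simp)
    qed
    from LIMSEQ_D[OF this, of "e / 4"] e obtain n0 where
      n0: "\<And>n. n \<ge> n0 \<Longrightarrow> \<bar>I (\<nu> n) - I \<nu>'\<bar> < e / 4" by auto
    show "\<exists>no. \<forall>n\<ge>no. norm ((\<integral>t. cts_step x y t \<partial>\<nu> n) - (\<integral>t. cts_step x y t \<partial>\<nu>')) < e"
    proof (intro exI allI impI)
      fix n assume "n \<ge> n0"
      then show "norm ((\<integral>t. cts_step x y t \<partial>\<nu> n) - (\<integral>t. cts_step x y t \<partial>\<nu>')) < e"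
        using n0[of n] approx[OF \<nu> pos, of n] approx[OF \<nu>' pos'] e
        unfolding real_norm_def by linarith
    qed
  qed
qed

section \<open>Gamma distributions\<close>

lemma nn_integral_powr_exp_Gamma:
  fixes p a :: real
  assumes p: "p > 0" and a: "a > 0"
  shows "(\<integral>\<^sup>+x. ennreal (indicator {0<..} x * (x powr (p - 1) * exp (- (a * x)))) \<partial>lborel)
       = ennreal (Gamma p * a powr (- p))"
proof -
  let ?f = "\<lambda>t. ennreal (indicator {0<..} t * (t powr (p - 1) * exp (- t)))"
  have "ennreal (Gamma p) = (\<integral>\<^sup>+t. ?f t \<partial>lborel)"
    unfolding Gamma_conv_nn_integral_real[OF p]
    by (intro nn_integral_cong) (auto simp: indicator_def exp_minus divide_inverse)
  also have "\<dots> = ennreal a * (\<integral>\<^sup>+x. ?f (0 + a * x) \<partial>lborel)"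
    using a by (subst nn_integral_real_affine[where c = a and t = 0]) auto
  also have "\<dots> = ennreal a * (\<integral>\<^sup>+x. ennreal (a powr (p - 1)) *
      ennreal (indicator {0<..} x * (x powr (p - 1) * exp (- (a * x)))) \<partial>lborel)"
    using a by (intro arg_cong[where f = "\<lambda>u. ennreal a * u"] nn_integral_cong)
      (auto simp: indicator_def zero_less_mult_iff powr_mult ennreal_mult[symmetric])
  also have "\<dots> = ennreal (a powr p) *
      (\<integral>\<^sup>+x. ennreal (indicator {0<..} x * (x powr (p - 1) * exp (- (a * x)))) \<partial>lborel)"
    using a by (subst nn_integral_cmult) (auto simp: mult.assoc[symmetric] ennreal_mult[symmetric] powr_diff)
  finally have "ennreal (a powr (- p)) * ennreal (Gamma p) = ennreal (a powr (- p)) * (ennreal (a powr p) *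
      (\<integral>\<^sup>+x. ennreal (indicator {0<..} x * (x powr (p - 1) * exp (- (a * x)))) \<partial>lborel))"
    by simp
  moreover have "ennreal (a powr (- p)) * ennreal (a powr p) = 1"
    using a by (simp add: ennreal_mult[symmetric] powr_add[symmetric])
  ultimately have "ennreal (a powr (- p)) * ennreal (Gamma p) =
      (\<integral>\<^sup>+x. ennreal (indicator {0<..} x * (x powr (p - 1) * exp (- (a * x)))) \<partial>lborel)"
    by (simp only: mult.assoc[symmetric] mult_1)
  moreover have "ennreal (a powr (- p)) * ennreal (Gamma p) = ennreal (Gamma p * a powr (- p))"
    by (subst mult.commute[of "Gamma p"]) (rule ennreal_mult'[symmetric], simp)
  ultimately show ?thesis by simp
qed

lemma gamma_density_nonneg: "k > 0 \<Longrightarrow> \<theta> > 0 \<Longrightarrow> 0 \<le> gamma_density k \<theta> x"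
  by (simp add: gamma_density_def)

lemma gamma_density_measurable[measurable]: "gamma_density k \<theta> \<in> borel_measurable borel"
  unfolding gamma_density_def by measurable

text \<open>
  Moments and Laplace transform at once: the factor \<open>exp (-l x)\<close> only changes the rate \<open>1/\<theta>\<close> of the density
  to \<open>1/\<theta> + l\<close>, and \<open>x ^ j\<close> its shape from \<open>k\<close> to \<open>k + j\<close>.
\<close>

lemma nn_integral_gamma_density_power_exp:
  fixes k \<theta> l :: real
  assumes k: "k > 0" and \<theta>: "\<theta> > 0" and l: "l \<ge> 0"
  shows "(\<integral>\<^sup>+x. ennreal (gamma_density k \<theta> x * (x ^ j * exp (- (l * x)))) \<partial>lborel)
    = ennreal (Gamma (k + real j) / Gamma k * \<theta> ^ j * (1 + \<theta> * l) powr (- (k + real j)))"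
proof -
  define c where "c = inverse (Gamma k * \<theta> powr k)"
  have c: "c \<ge> 0" using k \<theta> by (simp add: c_def)
  define a where "a = 1 / \<theta> + l"
  have a: "a > 0" using \<theta> l by (simp add: a_def add_pos_nonneg)
  have kj: "k + real j > 0" using k by simp
  have "gamma_density k \<theta> x * (x ^ j * exp (- (l * x)))
      = c * (indicator {0<..} x * (x powr (k + real j - 1) * exp (- (a * x))))" for x
  proof (cases "x > 0")
    case True
    have "x powr (k - 1) * x ^ j = x powr (k + real j - 1)"
      using True by (simp add: powr_realpow[symmetric] powr_add[symmetric] algebra_simps)
    moreover have "exp (- x / \<theta>) * exp (- (l * x)) = exp (- (a * x))"
      by (simp add: exp_add[symmetric] a_def algebra_simps)
    ultimately show ?thesis
      using True by (simp add: gamma_density_def c_def divide_inverse mult_ac)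
  qed (simp add: gamma_density_def)
  then have "(\<integral>\<^sup>+x. ennreal (gamma_density k \<theta> x * (x ^ j * exp (- (l * x)))) \<partial>lborel)
      = (\<integral>\<^sup>+x. ennreal c * ennreal (indicator {0<..} x * (x powr (k + real j - 1) * exp (- (a * x)))) \<partial>lborel)"
    using c by (simp add: ennreal_mult')
  also have "\<dots> = ennreal c * ennreal (Gamma (k + real j) * a powr (- (k + real j)))"
    by (subst nn_integral_cmult) (auto simp: nn_integral_powr_exp_Gamma[OF kj a])
  also have "\<dots> = ennreal (c * (Gamma (k + real j) * a powr (- (k + real j))))"
    using c by (simp add: ennreal_mult')
  also have "a = (1 + \<theta> * l) / \<theta>"
    using \<theta> by (simp add: a_def field_simps)
  also have "((1 + \<theta> * l) / \<theta>) powr (- (k + real j))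
      = (1 + \<theta> * l) powr (- (k + real j)) * (\<theta> powr k * \<theta> ^ j)"
  proof -
    have "\<theta> powr (- (k + real j)) = inverse (\<theta> powr k * \<theta> ^ j)"
      using \<theta> by (simp only: powr_minus powr_add powr_realpow)
    moreover have "((1 + \<theta> * l) / \<theta>) powr (- (k + real j))
        = (1 + \<theta> * l) powr (- (k + real j)) / \<theta> powr (- (k + real j))"
      by (rule powr_divide)
    ultimately show ?thesis
      by (simp add: divide_inverse del: minus_add_distrib)
  qed
  finally show ?thesis
    using \<theta> by (simp add: c_def field_simps)
qed

lemma gamma_distribution_power_exp:
  fixes k \<theta> l :: real
  assumes k: "k > 0" and \<theta>: "\<theta> > 0" and l: "l \<ge> 0"
  shows "has_bochner_integral (gamma_distribution k \<theta>) (\<lambda>x. x ^ j * exp (- (l * x)))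
    (Gamma (k + real j) / Gamma k * \<theta> ^ j * (1 + \<theta> * l) powr (- (k + real j)))"
proof -
  have "has_bochner_integral lborel (\<lambda>x. gamma_density k \<theta> x *\<^sub>R (x ^ j * exp (- (l * x))))
    (Gamma (k + real j) / Gamma k * \<theta> ^ j * (1 + \<theta> * l) powr (- (k + real j)))"
  proof (rule has_bochner_integral_nn_integral)
    show "AE x in lborel. 0 \<le> gamma_density k \<theta> x *\<^sub>R (x ^ j * exp (- (l * x)))"
      using k \<theta> by (intro AE_I2) (simp add: gamma_density_def)
    show "(\<integral>\<^sup>+x. ennreal (gamma_density k \<theta> x *\<^sub>R (x ^ j * exp (- (l * x)))) \<partial>lborel)
      = ennreal (Gamma (k + real j) / Gamma k * \<theta> ^ j * (1 + \<theta> * l) powr (- (k + real j)))"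
      using nn_integral_gamma_density_power_exp[OF assms] by simp
    show "0 \<le> Gamma (k + real j) / Gamma k * \<theta> ^ j * (1 + \<theta> * l) powr (- (k + real j))"
      using k \<theta> Gamma_real_pos[of k] Gamma_real_pos[of "k + real j"] by simp
  qed auto
  then show ?thesis
    unfolding gamma_distribution_def
    by (intro has_bochner_integral_density) (auto simp: gamma_density_nonneg[OF k \<theta>])
qed

lemma Gamma_plus1_pos:
  fixes k :: real
  assumes "k > 0" shows "Gamma (k + 1) = k * Gamma k"
  using assms by (intro Gamma_plus1) (auto elim!: nonpos_Ints_cases)

lemma Gamma_pos_neq_0: "k > 0 \<Longrightarrow> Gamma (k :: real) \<noteq> 0"
  using Gamma_real_pos[of k] by linarith

lemma prob_space_gamma_distribution:
  assumes "k > 0" "\<theta> > 0" shows "prob_space (gamma_distribution k \<theta>)"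
proof
  have "emeasure (gamma_distribution k \<theta>) (space (gamma_distribution k \<theta>))
      = (\<integral>\<^sup>+x. ennreal (gamma_density k \<theta> x * (x ^ 0 * exp (- (0 * x)))) \<partial>lborel)"
    unfolding gamma_distribution_def by (subst emeasure_density) auto
  also have "\<dots> = 1"
    using assms Gamma_pos_neq_0[OF assms(1)] by (subst nn_integral_gamma_density_power_exp) auto
  finally show "emeasure (gamma_distribution k \<theta>) (space (gamma_distribution k \<theta>)) = 1" .
qed

lemma gamma_distribution_mean:
  assumes k: "k > 0" and \<theta>: "\<theta> > 0"
  shows "(\<integral>x. x \<partial>gamma_distribution k \<theta>) = k * \<theta>"
  using has_bochner_integral_integral_eq[OF gamma_distribution_power_exp[OF k \<theta> order_refl, of 1]]
    Gamma_plus1_pos[OF k] Gamma_pos_neq_0[OF k] by (simp add: add.commute)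

lemma gamma_distribution_variance:
  assumes k: "k > 0" and \<theta>: "\<theta> > 0"
  shows "prob_space.variance (gamma_distribution k \<theta>) (\<lambda>x. x) = k * \<theta>\<^sup>2"
proof -
  interpret prob_space "gamma_distribution k \<theta>" by (rule prob_space_gamma_distribution[OF k \<theta>])
  note m = gamma_distribution_power_exp[OF k \<theta> order_refl]
  have "Gamma (k + 2) = (k + 1) * (k * Gamma k)"
    using Gamma_plus1_pos[of k] Gamma_plus1_pos[of "k + 1"] k by (simp add: add.assoc)
  then have "expectation (\<lambda>x. x\<^sup>2) = k * (k + 1) * \<theta>\<^sup>2"
    using has_bochner_integral_integral_eq[OF m[of 2]] Gamma_pos_neq_0[OF k] by simp
  moreover have "integrable (gamma_distribution k \<theta>) (\<lambda>x. x)" "integrable (gamma_distribution k \<theta>) (\<lambda>x. x\<^sup>2)"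
    using integrable.intros[OF m[of 1]] integrable.intros[OF m[of 2]] by auto
  ultimately show ?thesis
    using gamma_distribution_mean[OF k \<theta>]
    by (simp add: variance_eq prob_space power2_eq_square algebra_simps)
qed

lemma gamma_distribution_laplace:
  assumes k: "k > 0" and \<theta>: "\<theta> > 0" and l: "l \<ge> 0"
  shows "(\<integral>x. exp (- (l * x)) \<partial>gamma_distribution k \<theta>) = (1 + \<theta> * l) powr (- k)"
  using has_bochner_integral_integral_eq[OF gamma_distribution_power_exp[OF k \<theta> l, of 0]]
    Gamma_pos_neq_0[OF k] by simp

lemma AE_gamma_distribution_nonneg: "AE x in gamma_distribution k \<theta>. 0 \<le> x"
  unfolding gamma_distribution_def
  by (subst AE_density) (auto intro!: AE_I2 simp: gamma_density_def)

section \<open>The limit theorem\<close>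

theorem theorem4:
  fixes M :: "'a measure" and N :: "'b measure"
    and P :: "real \<Rightarrow> real measure" and X :: "nat \<Rightarrow> 'a \<Rightarrow> real"
    and \<Xi> :: "'b \<Rightarrow> real" and \<mu> b :: real
  assumes chain: "markov_chain M nonneg_reals P X"
    and b_pos: "b > 0"
    and mu_gt: "\<mu> > - b / 2"
    and drift: "((\<lambda>x. x * (\<integral>z. z \<partial>jump_law P x)) \<longlongrightarrow> \<mu>) at_top"
    and second_moment: "((\<lambda>x. \<integral>z. z\<^sup>2 \<partial>jump_law P x) \<longlongrightarrow> b) at_top"
    and majorant_space: "prob_space N"
    and majorant_integrable: "integrable N \<Xi>"
    and majorant: "\<And>x. x \<ge> 0 \<Longrightarrow> st_le (jump_law P x) (\<lambda>z. z\<^sup>2) N \<Xi>"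
    and to_infinity: "\<And>c. (\<lambda>n. measure M {\<omega> \<in> space M. X n \<omega> > c}) \<longlonglongrightarrow> 1"
  shows "\<exists>k \<theta>. k > 0 \<and> \<theta> > 0
    \<and> prob_space.expectation (gamma_distribution k \<theta>) (\<lambda>x. x) = 2 * \<mu> + b
    \<and> prob_space.variance (gamma_distribution k \<theta>) (\<lambda>x. x) = (2 * \<mu> + b) * (2 * b)
    \<and> weak_conv_m (\<lambda>n. distr M borel (\<lambda>\<omega>. (X n \<omega>)\<^sup>2 / real n)) (gamma_distribution k \<theta>)"
proof -
  interpret markov_chain M nonneg_reals P X by (rule chain)
  define k \<theta> where "k = (2 * \<mu> + b) / (2 * b)" and "\<theta> = 2 * b"
  have k: "k > 0" and \<theta>: "\<theta> > 0" and kb: "2 * b * k = 2 * \<mu> + b"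
    using b_pos mu_gt by (auto simp: k_def \<theta>_def)
  let ?\<Gamma> = "gamma_distribution k \<theta>"
  have X_borel[measurable]: "X n \<in> borel_measurable M" for n
    using random_variable_X[of n] by (simp add: nonneg_reals_def measurable_restrict_space2_iff)
  have scaled[measurable]: "(\<lambda>\<omega>. (X n \<omega>)\<^sup>2 / real n) \<in> borel_measurable M" for n
    by measurable
  have "weak_conv_m (\<lambda>n. distr M borel (\<lambda>\<omega>. (X n \<omega>)\<^sup>2 / real n)) ?\<Gamma>"
  proof (rule real_distribution_laplace_imp_weak_conv)
    show "real_distribution (distr M borel (\<lambda>\<omega>. (X n \<omega>)\<^sup>2 / real n))" for n
      by (rule real_distribution_distr) (rule scaled)
    show "real_distribution ?\<Gamma>"
      using prob_space_gamma_distribution[OF k \<theta>]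
      by (simp add: real_distribution_def real_distribution_axioms_def gamma_distribution_def)
    show "AE y in distr M borel (\<lambda>\<omega>. (X n \<omega>)\<^sup>2 / real n). 0 \<le> y" for n
      by (subst AE_distr_iff) auto
    show "AE y in ?\<Gamma>. 0 \<le> y" by (rule AE_gamma_distribution_nonneg)
    fix m :: nat assume m: "m \<ge> 1"
    have "(\<lambda>n. \<integral>\<omega>. exp (- (real m * ((X n \<omega>)\<^sup>2 / real n))) \<partial>M) \<longlonglongrightarrow> (1 + 2 * b * real m) powr (- k)"
      by (rule square_laplace_transform_tendsto[OF chain b_pos k kb drift second_moment
            majorant_space majorant_integrable majorant to_infinity]) (use m in auto)
    moreover have "(\<integral>y. exp (- (real m * y)) \<partial>distr M borel (\<lambda>\<omega>. (X n \<omega>)\<^sup>2 / real n))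
        = (\<integral>\<omega>. exp (- (real m * ((X n \<omega>)\<^sup>2 / real n))) \<partial>M)" for n
      by (subst integral_distr) auto
    moreover have "(\<integral>y. exp (- (real m * y)) \<partial>?\<Gamma>) = (1 + 2 * b * real m) powr (- k)"
      using gamma_distribution_laplace[OF k \<theta>, of "real m"] by (simp add: \<theta>_def)
    ultimately show "(\<lambda>n. \<integral>y. exp (- (real m * y)) \<partial>distr M borel (\<lambda>\<omega>. (X n \<omega>)\<^sup>2 / real n))
        \<longlonglongrightarrow> (\<integral>y. exp (- (real m * y)) \<partial>?\<Gamma>)"
      by simp
  qed
  moreover have "(\<integral>x. x \<partial>?\<Gamma>) = 2 * \<mu> + b"
    using gamma_distribution_mean[OF k \<theta>] kb by (simp add: \<theta>_def mult.commute)
  moreover have "prob_space.variance ?\<Gamma> (\<lambda>x. x) = (2 * \<mu> + b) * (2 * b)"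
    unfolding gamma_distribution_variance[OF k \<theta>] kb[symmetric] by (simp add: \<theta>_def power2_eq_square)
  ultimately show ?thesis using k \<theta> by (intro exI[of _ k] exI[of _ \<theta>] conjI)
qed

end
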